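(* Let $k$ be a field of characteristic zero, let $L$ be the free preLie algebra over $k$ on a single generator $a$, and let $\widehat L$ be its completion. Let $\Omega\in\widehat L$ be the Magnus element, i.e. the (necessarily unique) solution in $\widehat L$ of $$a\curvearrowleft\left(\frac{\Omega}{\exp(\Omega)-1}\right)=\Omega,$$ where $\frac{\Omega}{\exp(\Omega)-1}$ is computed with respect to the product $\ast$ of the completed enveloping algebra $\widehat{S^\ast(L)}$. Let $\exp(a):=\sum_{n\ge0}\frac{a^n}{n!}\in\widehat{S(L)}$, where $a^n$ is the $n$-th power of $a$ in the symmetric algebra $S(L)$. Then $$\Omega=sol_1(\exp(a))=\log^\ast(\exp(a)).$$
   Context: A (right) preLie algebra over a field $k$ is a $k$-vector space $L$ with a bilinear map $\curvearrowleft$ such that $(x\curvearrowleft y)\curvearrowleft z-x\curvearrowleft(y\curvearrowleft z)=(x\curvearrowleft z)\curvearrowleft y-x\curvearrowleft(z\curvearrowleft y)$ for all $x,y,z\in L$. The bracket $[x,y]:=x\curvearrowleft y-y\curvearrowleft x$ makes $L$ a Lie algebra, denoted $L_{Lie}$. Symmetric algebra: $S(L)=\bigoplus_{n\ge0}S^n(L)$ is the symmetric algebra of the vector space $L$; the commutative product of $l_1,\dots,l_n\in L$ is written $l_1\cdots l_n$. Action of $S(L)$ on $L$: for $c\in L$, the expression $c\curvearrowleft B$ with $B\in S(L)$ is linear in $B$ and determined by $c\curvearrowleft 1=c$, by the preLie product for $B\in L$, and by $$c\curvearrowleft(b_1\cdots b_mb)=(c\curvearrowleft(b_1\cdots b_m))\curvearrowleft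 b-\sum_{i=1}^m c\curvearrowleft(b_1\cdots(b_i\curvearrowleft b)\cdots b_m)$$ for $b_1,\dots,b_m,b\in L$. Product $\ast$: for $a_1,\dots,a_l,b_1,\dots,b_m\in L$, $$(a_1\cdots a_l)\ast(b_1\cdots b_m)=\sum_f B_0\,(a_1\curvearrowleft B_1)\cdots(a_l\curvearrowleft B_l),$$ where the sum is over all functions $f:\{1,\dots,m\}\to\{0,\dots,l\}$ and $B_i:=\prod_{j\in f^{-1}(i)}b_j$. The product $\ast$ is associative and unital, and $S^\ast(L):=(S(L),\ast)$ is an enveloping algebra of $L_{Lie}$ (a known result). The action above is a right action of $S^\ast(L)$ on $L$: $c\curvearrowleft(B\ast C)=(c\curvearrowleft B)\curvearrowleft C$; in particular $c\curvearrowleft x^{\ast n}=(\cdots((c\curvearrowleft x)\curvearrowleft x)\cdots)\curvearrowleft x$ ($n$ times) for $x\in L$. Completions: $L=\bigoplus_{n\ge1}L_n$ is graded by the length of preLie products of the generator $a$ ($a$ has degree 1), and $\widehat L=\prod_{n\geq 1}L_n$. The grading of $L$ induces a grading on $S(L)$, compatible with $\ast$ and with the action on $L$; $\widehat{S(L)}=\widehat{S^\ast(L)}$ denotes the corresponding completion (product of the graded components), to which $\ast$, the action $\curvearrowleft$ (on $\widehat L$) and the graded linear map $sol_1$ below extend. Series: for $\Omega\in\widehat L$, $\frac{\Omega}{\exp(\Omega)-1}:=\sum_{n\ge0}\frac{B_n}{n!}\Omega^{\ast n}\in\widehat{S^\ast(L)}$, where the $B_n$ are the Bernoulli numbers, defined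 by $\frac{x}{e^x-1}=\sum_{n\ge0}\frac{B_n}{n!}x^n$. For $u\in\widehat{S^\ast(L)}$ with degree-zero component $1$, $\log^\ast(u):=\sum_{n>0}(-1)^{n-1}\frac{(u-1)^{\ast n}}{n}$ (powers for the product $\ast$). Projection $sol_1$: the PBW isomorphism is the linear isomorphism $S(L)\to S^\ast(L)$, $l_1\cdots l_n\mapsto\frac1{n!}\sum_{\sigma\in S_n}l_{\sigma(1)}\ast\cdots\ast l_{\sigma(n)}$. Let $P_i$ be the image of $S^i(L)$ under this map, so that $S^\ast(L)=\bigoplus_{i\ge0}P_i$ and $P_1=L$. The map $sol_1$ is the projection of $S^\ast(L)$ onto $P_1=L$ with kernel $\bigoplus_{j\neq1}P_j$. *)

theory Defs
  imports
    "HOL-Library.Poly_Mapping"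
    "HOL-Library.Multiset"
    "HOL-Library.FuncSet"
    "HOL-Combinatorics.Permutations"
    "HOL-Computational_Algebra.Formal_Power_Series"
begin

section \<open>Finitely supported linear combinations\<close>

definition pm_scale :: "'k::comm_ring_1 \<Rightarrow> ('b \<Rightarrow>\<^sub>0 'k) \<Rightarrow> ('b \<Rightarrow>\<^sub>0 'k)" where
  "pm_scale c p = Poly_Mapping.map ((*) c) p"

lemma lookup_pm_scale [simp]: "Poly_Mapping.lookup (pm_scale c p) b = c * Poly_Mapping.lookup p b"
  by (simp add: pm_scale_def Poly_Mapping.map.rep_eq when_def)

interpretation pm: module pm_scale
  by standard (auto intro!: poly_mapping_eqI simp: lookup_add algebra_simps)

lemma pm_scale_single [simp]: "pm_scale c (Poly_Mapping.single b d) = Poly_Mapping.single b (c * d)"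
  by (rule poly_mapping_eqI) (simp add: lookup_single when_def)

definition lin_ext ::
    "('k::comm_ring_1 \<Rightarrow> 'v::ab_group_add \<Rightarrow> 'v) \<Rightarrow> ('b \<Rightarrow> 'v) \<Rightarrow> ('b \<Rightarrow>\<^sub>0 'k) \<Rightarrow> 'v" where
  "lin_ext s F p = (\<Sum>b\<in>Poly_Mapping.keys p. s (Poly_Mapping.lookup p b) (F b))"

context module
begin

lemma lin_ext_superset:
  assumes "finite A" "Poly_Mapping.keys p \<subseteq> A"
  shows "lin_ext scale F p = (\<Sum>b\<in>A. scale (Poly_Mapping.lookup p b) (F b))"
  unfolding lin_ext_def using assms
  by (intro sum.mono_neutral_left) (auto simp: in_keys_iff)

lemma lin_ext_zero [simp]: "lin_ext scale F 0 = 0"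
  by (simp add: lin_ext_def)

lemma lin_ext_add: "lin_ext scale F (p + q) = lin_ext scale F p + lin_ext scale F q"
proof -
  let ?A = "Poly_Mapping.keys p \<union> Poly_Mapping.keys q"
  have "lin_ext scale F r = (\<Sum>b\<in>?A. scale (Poly_Mapping.lookup r b) (F b))" if "Poly_Mapping.keys r \<subseteq> ?A" for r
    using that by (intro lin_ext_superset) auto
  then show ?thesis
    by (simp add: Poly_Mapping.keys_add lookup_add scale_left_distrib sum.distrib)
qed

lemma lin_ext_scale: "lin_ext scale F (pm_scale c p) = scale c (lin_ext scale F p)"
proof -
  have "Poly_Mapping.keys (pm_scale c p) \<subseteq> Poly_Mapping.keys p" by (auto simp: in_keys_iff)
  then have "lin_ext scale F (pm_scale c p) = (\<Sum>b\<in>Poly_Mapping.keys p. scale (Poly_Mapping.lookup (pm_scale c p) b) (F b))"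
    by (intro lin_ext_superset) auto
  then show ?thesis by (simp add: lin_ext_def scale_sum_right)
qed

lemma lin_ext_minus: "lin_ext scale F (- p) = - lin_ext scale F p"
  using lin_ext_add[of F p "- p"] by (simp add: eq_neg_iff_add_eq_0 add.commute)

lemma lin_ext_diff: "lin_ext scale F (p - q) = lin_ext scale F p - lin_ext scale F q"
  using lin_ext_add[of F p "- q"] by (simp add: lin_ext_minus)

lemma lin_ext_sum: "lin_ext scale F (sum g A) = (\<Sum>i\<in>A. lin_ext scale F (g i))"
  by (induction A rule: infinite_finite_induct) (simp_all add: lin_ext_add)

lemma lin_ext_single [simp]: "lin_ext scale F (Poly_Mapping.single b c) = scale c (F b)"
  by (cases "c = 0") (simp_all add: lin_ext_def)

end

lemma pm_expand: "(\<Sum>b\<in>Poly_Mapping.keys p. Poly_Mapping.single b (Poly_Mapping.lookup p b)) = p"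
proof (rule poly_mapping_eqI)
  fix k
  show "Poly_Mapping.lookup (\<Sum>b\<in>Poly_Mapping.keys p. Poly_Mapping.single b (Poly_Mapping.lookup p b)) k = Poly_Mapping.lookup p k"
    by (cases "k \<in> Poly_Mapping.keys p") (auto simp: lookup_sum lookup_single when_def in_keys_iff)
qed

lemma pm_induct [case_names zero add]:
  fixes p :: "'b \<Rightarrow>\<^sub>0 'k::comm_monoid_add"
  assumes "P 0" "\<And>b c p. P p \<Longrightarrow> P (Poly_Mapping.single b c + p)"
  shows "P p"
proof -
  have "P (\<Sum>b\<in>A. Poly_Mapping.single b (Poly_Mapping.lookup p b))" if "finite A" for A
    using that by (induction rule: finite_induct) (auto simp: assms)
  from this[of "Poly_Mapping.keys p"] show ?thesis by (simp add: pm_expand)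
qed

section \<open>The free preLie algebra on one generator\<close>

text \<open>
  The free preLie algebra is constructed as the free nonassociative algebra, which has the
  bracketings of the generator as a basis, modulo the two-sided ideal generated by the preLie
  relations. Its universal property is \<open>prelie_universal\<close>.
\<close>

datatype mag = Gen | Node mag mag

primrec mag_fold :: "('v \<Rightarrow> 'v \<Rightarrow> 'v) \<Rightarrow> 'v \<Rightarrow> mag \<Rightarrow> 'v" where
  "mag_fold m v Gen = v"
| "mag_fold m v (Node s t) = m (mag_fold m v s) (mag_fold m v t)"

fun leaves :: "mag \<Rightarrow> nat" where
  "leaves Gen = 1"
| "leaves (Node s t) = leaves s + leaves t"

lemma leaves_pos: "0 < leaves t"
  by (induction t) auto

definition mag_mult :: "(mag \<Rightarrow>\<^sub>0 'k::comm_ring_1) \<Rightarrow> (mag \<Rightarrow>\<^sub>0 'k) \<Rightarrow> (mag \<Rightarrow>\<^sub>0 'k)" where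
  "mag_mult p q =
    (\<Sum>s\<in>Poly_Mapping.keys p. \<Sum>t\<in>Poly_Mapping.keys q.
      Poly_Mapping.single (Node s t) (Poly_Mapping.lookup p s * Poly_Mapping.lookup q t))"

lemma mag_mult_lin_ext:
  "mag_mult p q = lin_ext pm_scale (\<lambda>s. lin_ext pm_scale (\<lambda>t. Poly_Mapping.single (Node s t) 1) q) p"
  by (simp add: mag_mult_def lin_ext_def pm.scale_sum_right)

lemma lin_ext_fun_add:
  "module s \<Longrightarrow> lin_ext s (\<lambda>b. F b + G b) p = lin_ext s F p + lin_ext s G p"
  by (simp add: lin_ext_def module.scale_right_distrib sum.distrib)

lemma lin_ext_fun_scale:
  "module s \<Longrightarrow> lin_ext s (\<lambda>b. s c (F b)) p = s c (lin_ext s F p)"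
  by (simp add: lin_ext_def module.scale_sum_right module.scale_left_commute)

lemma mag_mult_add_left: "mag_mult (p + p') q = mag_mult p q + mag_mult p' q"
  by (simp add: mag_mult_lin_ext pm.lin_ext_add)

lemma mag_mult_add_right: "mag_mult p (q + q') = mag_mult p q + mag_mult p q'"
  by (simp add: mag_mult_lin_ext pm.lin_ext_add lin_ext_fun_add[OF pm.module_axioms])

lemma mag_mult_scale_left: "mag_mult (pm_scale c p) q = pm_scale c (mag_mult p q)"
  by (simp add: mag_mult_lin_ext pm.lin_ext_scale)

lemma mag_mult_scale_right: "mag_mult p (pm_scale c q) = pm_scale c (mag_mult p q)"
  by (simp add: mag_mult_lin_ext pm.lin_ext_scale lin_ext_fun_scale[OF pm.module_axioms])

lemma mag_mult_single [simp]:
  "mag_mult (Poly_Mapping.single s c) (Poly_Mapping.single t d) = Poly_Mapping.single (Node s t) (c * d)"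
  by (simp add: mag_mult_lin_ext)

lemma mag_mult_diff_left: "mag_mult (p - p') q = mag_mult p q - mag_mult p' q"
  by (simp add: mag_mult_lin_ext pm.lin_ext_diff)

lemma mag_mult_diff_right: "mag_mult p (q - q') = mag_mult p q - mag_mult p q'"
  using mag_mult_add_right[of p "q - q'" q'] by (simp add: algebra_simps)

inductive_set prelie_ideal :: "(mag \<Rightarrow>\<^sub>0 'k::comm_ring_1) set" where
  rel: "(mag_mult (mag_mult x y) z - mag_mult x (mag_mult y z))
      - (mag_mult (mag_mult x z) y - mag_mult x (mag_mult z y)) \<in> prelie_ideal"
| zero: "0 \<in> prelie_ideal"
| add: "u \<in> prelie_ideal \<Longrightarrow> v \<in> prelie_ideal \<Longrightarrow> u + v \<in> prelie_ideal"
| scale: "u \<in> prelie_ideal \<Longrightarrow> pm_scale c u \<in> prelie_ideal"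
| mult_right: "u \<in> prelie_ideal \<Longrightarrow> mag_mult u x \<in> prelie_ideal"
| mult_left: "u \<in> prelie_ideal \<Longrightarrow> mag_mult x u \<in> prelie_ideal"

lemma prelie_ideal_uminus: "u \<in> prelie_ideal \<Longrightarrow> - u \<in> prelie_ideal"
  using prelie_ideal.scale[of u "- 1"] by (simp add: pm.scale_minus_left)

lemma prelie_ideal_diff: "u \<in> prelie_ideal \<Longrightarrow> v \<in> prelie_ideal \<Longrightarrow> u - v \<in> prelie_ideal"
  using prelie_ideal.add[of u "- v"] by (simp add: prelie_ideal_uminus)

definition prelie_rel :: "(mag \<Rightarrow>\<^sub>0 'k::comm_ring_1) \<Rightarrow> (mag \<Rightarrow>\<^sub>0 'k) \<Rightarrow> bool" where
  "prelie_rel p q \<longleftrightarrow> p - q \<in> prelie_ideal"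

lemma equivp_prelie_rel: "equivp prelie_rel"
proof (rule equivpI)
  show "reflp prelie_rel" by (simp add: reflp_def prelie_rel_def prelie_ideal.zero)
  show "symp prelie_rel"
    using prelie_ideal_uminus by (fastforce simp: symp_def prelie_rel_def)
  show "transp prelie_rel"
    using prelie_ideal.add by (fastforce simp: transp_def prelie_rel_def)
qed

quotient_type (overloaded) 'k prelie = "mag \<Rightarrow>\<^sub>0 'k::field" / prelie_rel
  by (rule equivp_prelie_rel)

instantiation prelie :: (field) ab_group_add
begin
lift_definition zero_prelie :: "'a prelie" is 0 .
lift_definition plus_prelie :: "'a prelie \<Rightarrow> 'a prelie \<Rightarrow> 'a prelie" is "(+)"
  unfolding prelie_rel_def
  by (metis add_diff_add prelie_ideal.add)
lift_definition uminus_prelie :: "'a prelie \<Rightarrow> 'a prelie" is "uminus"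
  unfolding prelie_rel_def
  using prelie_ideal_uminus by fastforce
lift_definition minus_prelie :: "'a prelie \<Rightarrow> 'a prelie \<Rightarrow> 'a prelie" is "(-)"
  unfolding prelie_rel_def
  by (metis diff_diff_eq diff_diff_eq2 add_diff_eq diff_add_eq prelie_ideal_diff)
instance
  by standard (transfer; simp add: prelie_rel_def prelie_ideal.zero algebra_simps)+
end

lift_definition gen :: "'k::field prelie" is "Poly_Mapping.single Gen 1" .

lift_definition prelie_scale :: "'k::field \<Rightarrow> 'k prelie \<Rightarrow> 'k prelie" is pm_scale
  unfolding prelie_rel_def
  by (metis pm.scale_right_diff_distrib prelie_ideal.scale)

lift_definition prelie_mult :: "'k::field prelie \<Rightarrow> 'k prelie \<Rightarrow> 'k prelie" (infixl \<open>\<lhd>\<close> 75) is mag_mult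
proof -
  fix p p' q q' :: "mag \<Rightarrow>\<^sub>0 'k" assume "prelie_rel p p'" "prelie_rel q q'"
  then have "mag_mult (p - p') q + mag_mult p' (q - q') \<in> prelie_ideal"
    by (auto simp: prelie_rel_def intro: prelie_ideal.intros)
  then show "prelie_rel (mag_mult p q) (mag_mult p' q')"
    by (simp add: prelie_rel_def mag_mult_diff_left mag_mult_diff_right)
qed

interpretation L: vector_space "prelie_scale :: 'k::field \<Rightarrow> _"
  by standard (transfer; simp add: prelie_rel_def prelie_ideal.zero pm.scale_right_distrib pm.scale_left_distrib)+

lemma prelie_mult_add_left: "(x + y) \<lhd> z = x \<lhd> z + y \<lhd> z"
  by transfer (simp add: mag_mult_add_left prelie_rel_def prelie_ideal.zero)

lemma prelie_mult_add_right: "x \<lhd> (y + z) = x \<lhd> y + x \<lhd> z"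
  by transfer (simp add: mag_mult_add_right prelie_rel_def prelie_ideal.zero)

lemma prelie_mult_scale_left: "prelie_scale c x \<lhd> y = prelie_scale c (x \<lhd> y)"
  by transfer (simp add: mag_mult_scale_left prelie_rel_def prelie_ideal.zero)

lemma prelie_mult_scale_right: "x \<lhd> prelie_scale c y = prelie_scale c (x \<lhd> y)"
  by transfer (simp add: mag_mult_scale_right prelie_rel_def prelie_ideal.zero)

lemma prelie_identity:
  "(x \<lhd> y) \<lhd> z - x \<lhd> (y \<lhd> z) = (x \<lhd> z) \<lhd> y - x \<lhd> (z \<lhd> y)"
  by transfer (simp add: prelie_rel_def prelie_ideal.rel)

lemma prelie_expand_induct [case_names zero add]:
  fixes x :: "'k::field prelie"
  assumes "P 0" "\<And>c t x. P x \<Longrightarrow> P (prelie_scale c (mag_fold (\<lhd>) gen t) + x)"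
  shows "P x"
proof -
  have mag: "mag_fold (\<lhd>) gen t = abs_prelie (Poly_Mapping.single t (1 :: 'k))" for t
    by (induction t) (simp_all add: gen_def prelie_mult.abs_eq)
  have "P (abs_prelie p)" for p
  proof (induction p rule: pm_induct)
    case zero
    then show ?case using assms(1) by (simp add: zero_prelie.abs_eq)
  next
    case (add t c p)
    have "abs_prelie (Poly_Mapping.single t c + p) =
        prelie_scale c (mag_fold (\<lhd>) gen t) + abs_prelie p"
      by (simp add: plus_prelie.abs_eq[symmetric] mag prelie_scale.abs_eq)
    then show ?case using assms(2)[OF add] by simp
  qed
  then show ?thesis by (metis Quotient_prelie Quotient_abs_rep)
qed

lemma prelie_universal:
  fixes s :: "'k::field \<Rightarrow> 'v::ab_group_add \<Rightarrow> 'v" and m :: "'v \<Rightarrow> 'v \<Rightarrow> 'v" and v :: 'v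
  assumes s: "vector_space s"
    and m: "\<And>x y z. m (x + y) z = m x z + m y z" "\<And>x y z. m x (y + z) = m x y + m x z"
      "\<And>c x y. m (s c x) y = s c (m x y)" "\<And>c x y. m x (s c y) = s c (m x y)"
    and prelie: "\<And>x y z. m (m x y) z - m x (m y z) = m (m x z) y - m x (m z y)"
  shows "\<exists>!h. h gen = v \<and> (\<forall>x y. h (x + y) = h x + h y) \<and>
    (\<forall>c x. h (prelie_scale c x) = s c (h x)) \<and> (\<forall>x y. h (x \<lhd> y) = m (h x) (h y))"
proof -
  interpret vector_space s by fact
  let ?E = "lin_ext s (mag_fold m v)"
  have zero: "m 0 x = 0" "m x 0 = 0" for x
    using m(3)[of 0 0 x] m(4)[of x 0 0] by simp_all
  have single: "?E (mag_mult (Poly_Mapping.single t c) q) = m (?E (Poly_Mapping.single t c)) (?E q)" for t c q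
    by (induction q rule: pm_induct)
      (simp_all add: mag_mult_add_right lin_ext_add m zero mag_mult_lin_ext[of _ 0])
  have hom: "?E (mag_mult p q) = m (?E p) (?E q)" for p q
    by (induction p rule: pm_induct)
      (simp_all add: mag_mult_add_left lin_ext_add m zero single mag_mult_lin_ext[of 0] del: lin_ext_single)
  have ideal: "u \<in> prelie_ideal \<Longrightarrow> ?E u = 0" for u
    by (induction rule: prelie_ideal.induct)
      (simp_all add: lin_ext_diff lin_ext_add lin_ext_scale hom prelie zero)
  define h where "h x = ?E (rep_prelie x)" for x
  have h: "h (abs_prelie p) = ?E p" for p
  proof -
    have "prelie_rel (rep_prelie (abs_prelie p)) p"
      using Quotient_rep_abs[OF Quotient_prelie] equivp_reflp[OF equivp_prelie_rel] by blast
    then have "?E (rep_prelie (abs_prelie p) - p) = 0" by (simp add: prelie_rel_def ideal)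
    then show ?thesis by (simp add: h_def lin_ext_diff)
  qed
  have rep: "\<exists>p. x = abs_prelie p" for x :: "'k prelie"
    by (metis Quotient_prelie Quotient_abs_rep)
  show ?thesis
  proof (rule ex1I[of _ h], intro conjI allI)
    show "h gen = v" by (simp add: gen_def h)
    show "h (x + y) = h x + h y" for x y
      using rep[of x] rep[of y] by (auto simp: plus_prelie.abs_eq h lin_ext_add)
    show "h (prelie_scale c x) = s c (h x)" for c x
      using rep[of x] by (auto simp: prelie_scale.abs_eq h lin_ext_scale)
    show "h (x \<lhd> y) = m (h x) (h y)" for x y
      using rep[of x] rep[of y] by (auto simp: prelie_mult.abs_eq h hom)
  next
    fix g assume g: "g gen = v \<and> (\<forall>x y. g (x + y) = g x + g y) \<and>
      (\<forall>c x. g (prelie_scale c x) = s c (g x)) \<and> (\<forall>x y. g (x \<lhd> y) = m (g x) (g y))"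
    have *: "f x = lin_ext s (mag_fold m v) (rep_prelie x)"
      if f: "f gen = v" "\<forall>x y. f (x + y) = f x + f y" "\<forall>c x. f (prelie_scale c x) = s c (f x)"
        "\<forall>x y. f (x \<lhd> y) = m (f x) (f y)" for f x
    proof -
      have fold: "f (mag_fold (\<lhd>) gen t) = mag_fold m v t" for t
        by (induction t) (simp_all add: f)
      have mag: "mag_fold (\<lhd>) gen t = abs_prelie (Poly_Mapping.single t (1 :: 'k))" for t
        by (induction t) (simp_all add: gen_def prelie_mult.abs_eq)
      have "f 0 = 0" using f(3)[rule_format, of 0 0] by simp
      then have "f x = h x"
      proof (induction x rule: prelie_expand_induct)
        case zero
        then show ?case by (simp add: zero_prelie_def h)
      next
        case (add c t x)
        have "h (prelie_scale c (mag_fold (\<lhd>) gen t) + x) = s c (mag_fold m v t) + h x"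
          using rep[of x] by (auto simp: mag prelie_scale.abs_eq plus_prelie.abs_eq h lin_ext_add)
        then show ?case using add f fold by simp
      qed
      then show ?thesis by (simp add: h_def)
    qed
    show "g = h" using g *[of g] by (auto simp: h_def)
  qed
qed

section \<open>The symmetric algebra of the free preLie algebra\<close>

text \<open>
  The polynomial algebra with one indeterminate for every vector of \<open>L\<close> (multisets are
  monomials) modulo the ideal that makes \<open>L \<rightarrow> S(L)\<close> linear. The product \<open>*\<close> of the
  resulting ring is the commutative product, and \<open>emb\<close> is the inclusion of \<open>L\<close>.
\<close>

inductive_set sym_ideal :: "('k::field prelie multiset \<Rightarrow>\<^sub>0 'k) set" where
  rel_add: "Poly_Mapping.single {#x + y#} 1
      - (Poly_Mapping.single {#x#} 1 + Poly_Mapping.single {#y#} 1) \<in> sym_ideal"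
| rel_scale: "Poly_Mapping.single {#prelie_scale c x#} 1 - Poly_Mapping.single {#x#} c \<in> sym_ideal"
| zero: "0 \<in> sym_ideal"
| add: "u \<in> sym_ideal \<Longrightarrow> v \<in> sym_ideal \<Longrightarrow> u + v \<in> sym_ideal"
| mult: "u \<in> sym_ideal \<Longrightarrow> p * u \<in> sym_ideal"

lemma sym_ideal_uminus: "u \<in> sym_ideal \<Longrightarrow> - u \<in> sym_ideal"
  using sym_ideal.mult[of u "- 1"] by simp

lemma sym_ideal_diff: "u \<in> sym_ideal \<Longrightarrow> v \<in> sym_ideal \<Longrightarrow> u - v \<in> sym_ideal"
  using sym_ideal.add[of u "- v"] by (simp add: sym_ideal_uminus)

lemma lin_ext_sym_ideal:
  fixes s :: "'k::field \<Rightarrow> 'v::ab_group_add \<Rightarrow> 'v"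
  assumes "module s"
    and add: "\<And>x y M. F (add_mset (x + y) M) = F (add_mset x M) + F (add_mset y M)"
    and scale: "\<And>c x M. F (add_mset (prelie_scale c x) M) = s c (F (add_mset x M))"
    and "u \<in> sym_ideal"
  shows "lin_ext s F u = 0"
proof -
  interpret module s by fact
  from \<open>u \<in> sym_ideal\<close> have "lin_ext s F (q * u) = 0" for q
  proof (induction arbitrary: q)
    case (rel_add x y)
    show ?case
      by (induction q rule: pm_induct)
        (simp_all add: distrib_right right_diff_distrib distrib_left mult_single lin_ext_add
          lin_ext_diff add scale_right_distrib)
  next
    case (rel_scale c x)
    show ?case
      by (induction q rule: pm_induct)
        (simp_all add: distrib_right right_diff_distrib mult_single lin_ext_add
          lin_ext_diff scale)
  next
    case (add u v)
    then show ?case by (simp add: distrib_left lin_ext_add)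
  next
    case (mult u p)
    then show ?case by (metis mult.assoc)
  qed simp
  from this[of 1] show ?thesis by simp
qed

definition sym_rel :: "('k::field prelie multiset \<Rightarrow>\<^sub>0 'k) \<Rightarrow> ('k prelie multiset \<Rightarrow>\<^sub>0 'k) \<Rightarrow> bool" where
  "sym_rel p q \<longleftrightarrow> p - q \<in> sym_ideal"

lemma sym_rel_refl [simp]: "sym_rel p p"
  by (simp add: sym_rel_def sym_ideal.zero)

lemma equivp_sym_rel: "equivp sym_rel"
proof (rule equivpI)
  show "reflp sym_rel" by (simp add: reflp_def)
  show "symp sym_rel"
    using sym_ideal_uminus by (fastforce simp: symp_def sym_rel_def)
  show "transp sym_rel"
    using sym_ideal.add by (fastforce simp: transp_def sym_rel_def)
qed

lemma one_notin_sym_ideal: "1 \<notin> (sym_ideal :: ('k::field prelie multiset \<Rightarrow>\<^sub>0 'k) set)"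
proof
  let ?F = "\<lambda>M :: 'k prelie multiset. if M = {#} then 1 else 0 :: 'k"
  assume "1 \<in> (sym_ideal :: ('k prelie multiset \<Rightarrow>\<^sub>0 'k) set)"
  moreover have "module ((*) :: 'k \<Rightarrow> 'k \<Rightarrow> 'k)" by standard (simp_all add: algebra_simps)
  ultimately have "lin_ext (*) ?F 1 = 0" by (intro lin_ext_sym_ideal) auto
  then show False by (simp add: lin_ext_def)
qed

quotient_type (overloaded) 'k symalg = "'k::field prelie multiset \<Rightarrow>\<^sub>0 'k" / sym_rel
  by (rule equivp_sym_rel)

instantiation symalg :: (field) comm_ring_1
begin
lift_definition zero_symalg :: "'a symalg" is 0 .
lift_definition one_symalg :: "'a symalg" is 1 .
lift_definition plus_symalg :: "'a symalg \<Rightarrow> 'a symalg \<Rightarrow> 'a symalg" is "(+)"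
  unfolding sym_rel_def
  by (metis add_diff_add sym_ideal.add)
lift_definition uminus_symalg :: "'a symalg \<Rightarrow> 'a symalg" is "uminus"
  unfolding sym_rel_def
  using sym_ideal_uminus by fastforce
lift_definition minus_symalg :: "'a symalg \<Rightarrow> 'a symalg \<Rightarrow> 'a symalg" is "(-)"
  unfolding sym_rel_def
  using sym_ideal_diff by (fastforce simp: algebra_simps)
lift_definition times_symalg :: "'a symalg \<Rightarrow> 'a symalg \<Rightarrow> 'a symalg" is "(*)"
proof -
  fix p p' q q' :: "'a prelie multiset \<Rightarrow>\<^sub>0 'a" assume "sym_rel p p'" "sym_rel q q'"
  then have "q * (p - p') + p' * (q - q') \<in> sym_ideal"
    by (auto simp: sym_rel_def intro: sym_ideal.intros)
  then show "sym_rel (p * q) (p' * q')"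
    by (simp add: sym_rel_def algebra_simps)
qed
instance
proof
  show "(0 :: 'a symalg) \<noteq> 1"
    by transfer (use sym_ideal_uminus[of "- 1"] one_notin_sym_ideal in \<open>auto simp: sym_rel_def\<close>)
qed (transfer; simp add: algebra_simps)+
end

lemma sym_rel_pm_scale: "sym_rel p q \<Longrightarrow> sym_rel (pm_scale c p) (pm_scale c q)"
  by (simp add: sym_rel_def pm_scale_def mult_map_scale_conv_mult sym_ideal.mult flip: right_diff_distrib)

lift_definition sym_scale :: "'k::field \<Rightarrow> 'k symalg \<Rightarrow> 'k symalg" is pm_scale
  by (rule sym_rel_pm_scale)

interpretation S: vector_space "sym_scale :: 'k::field \<Rightarrow> _"
  by standard (transfer; simp add: pm.scale_right_distrib pm.scale_left_distrib)+

definition emb :: "'k::field prelie \<Rightarrow> 'k symalg" where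
  "emb x = abs_symalg (Poly_Mapping.single {#x#} 1)"

lemma sym_scale_mult_left: "sym_scale c u * v = sym_scale c (u * v)"
  by transfer (simp add: pm_scale_def mult_map_scale_conv_mult mult.assoc)

lemma sym_scale_mult_right: "u * sym_scale c v = sym_scale c (u * v)"
  using sym_scale_mult_left[of c v u] by (simp add: mult.commute)

lemma emb_add: "emb (x + y) = emb x + emb y"
  by (simp add: emb_def plus_symalg.abs_eq symalg.abs_eq_iff sym_rel_def sym_ideal.rel_add)

lemma emb_scale: "emb (prelie_scale c x) = sym_scale c (emb x)"
  by (simp add: emb_def sym_scale.abs_eq symalg.abs_eq_iff sym_rel_def sym_ideal.rel_scale)

definition mon :: "'k::field prelie multiset \<Rightarrow> 'k symalg" where
  "mon M = abs_symalg (Poly_Mapping.single M 1)"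

lemma mon_empty [simp]: "mon {#} = 1"
  by (simp add: mon_def one_symalg_def flip: single_one)

lemma mon_add_mset: "mon (add_mset x M) = emb x * mon M"
  by (simp add: mon_def emb_def times_symalg.abs_eq mult_single)

lemma mon_mset: "mon (mset xs) = prod_list (map emb xs)"
  by (induction xs) (simp_all add: mon_add_mset)

lemma sym_induct [case_names zero add]:
  fixes u :: "'k::field symalg"
  assumes "P 0" "\<And>c M u. P u \<Longrightarrow> P (sym_scale c (mon M) + u)"
  shows "P u"
proof -
  have "P (abs_symalg p)" for p
  proof (induction p rule: pm_induct)
    case zero
    then show ?case using assms(1) by (simp add: zero_symalg.abs_eq)
  next
    case (add b c p)
    have "abs_symalg (Poly_Mapping.single b c + p) = sym_scale c (mon b) + abs_symalg p"
      by (simp add: plus_symalg.abs_eq[symmetric] mon_def sym_scale.abs_eq)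
    then show ?case using assms(2)[OF add] by simp
  qed
  then show ?thesis by (metis Quotient_symalg Quotient_abs_rep)
qed

section \<open>The action of the symmetric algebra\<close>

lemma prelie_mult_sum_left: "(\<Sum>i\<in>A. f i) \<lhd> y = (\<Sum>i\<in>A. f i \<lhd> y)"
proof (induction A rule: infinite_finite_induct)
  have "(0 + 0) \<lhd> y = 0 \<lhd> y + 0 \<lhd> y" by (rule prelie_mult_add_left)
  then have "0 \<lhd> y = 0" by simp
  then show "sum f {} \<lhd> y = (\<Sum>i\<in>{}. f i \<lhd> y)" "infinite A \<Longrightarrow> sum f A \<lhd> y = (\<Sum>i\<in>A. f i \<lhd> y)" for A
    by simp_all
qed (simp_all add: prelie_mult_add_left)

lemma prelie_mult_diff_left: "(x - x') \<lhd> y = x \<lhd> y - x' \<lhd> y"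
  using prelie_mult_add_left[of "x - x'" x' y] by (simp add: algebra_simps)

lemma prelie_mult_diff_right: "x \<lhd> (y - y') = x \<lhd> y - x \<lhd> y'"
  using prelie_mult_add_right[of x "y - y'" y'] by (simp add: algebra_simps)

text \<open>
  The head of the list is the factor that is split off in the recursion for
  \<open>c \<lhd> (b\<^sub>1 \<dots> b\<^sub>m b)\<close>; the result does not depend on the order of the factors
  (\<open>act_list_mset\<close>). The defining equations of the action on \<open>S(L)\<close> are \<open>act_one\<close>,
  \<open>act_emb\<close> and \<open>act_prod_snoc\<close>, together with linearity.
\<close>

function act_list :: "'k::field prelie \<Rightarrow> 'k prelie list \<Rightarrow> 'k prelie" where
  "act_list c [] = c"
| "act_list c (b # bs) =
    act_list c bs \<lhd> b - (\<Sum>i<length bs. act_list c (bs[i := bs ! i \<lhd> b]))"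
  by pat_completeness auto
termination by (relation "measure (\<lambda>(c, bs). length bs)") auto

lemma act_list_linear:
  "i < length bs \<Longrightarrow> act_list c (bs[i := prelie_scale r x + y]) =
     prelie_scale r (act_list c (bs[i := x])) + act_list c (bs[i := y])"
proof (induction "length bs" arbitrary: bs i x y)
  case (Suc n)
  then obtain b bs' where bs: "bs = b # bs'" "length bs' = n" by (cases bs) auto
  have IH: "act_list c (zs[i := prelie_scale r x + y]) =
     prelie_scale r (act_list c (zs[i := x])) + act_list c (zs[i := y])"
    if "length zs = n" "i < n" for zs i x y
    using Suc.hyps(1)[of zs] that by auto
  show ?case
  proof (cases i)
    case 0
    have "(\<Sum>i<n. act_list c (bs'[i := bs' ! i \<lhd> (prelie_scale r x + y)])) =
        (\<Sum>i<n. prelie_scale r (act_list c (bs'[i := bs' ! i \<lhd> x])) + act_list c (bs'[i := bs' ! i \<lhd> y]))"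
      by (intro sum.cong) (simp_all add: prelie_mult_add_right prelie_mult_scale_right IH bs)
    then show ?thesis
      by (simp add: 0 bs prelie_mult_add_right prelie_mult_scale_right sum.distrib
          L.scale_sum_right L.scale_right_diff_distrib algebra_simps)
  next
    case (Suc i')
    then have i': "i' < n" using \<open>i < length bs\<close> bs by simp
    let ?z = "\<lambda>w. act_list c (bs'[i' := w])"
    let ?t = "\<lambda>w j. act_list c (bs'[i' := w, j := bs'[i' := w] ! j \<lhd> b])"
    have "?t (prelie_scale r x + y) j = prelie_scale r (?t x j) + ?t y j" if "j < n" for j
    proof (cases "j = i'")
      case True
      then show ?thesis
        using IH[of bs' i'] i' bs by (simp add: prelie_mult_add_left prelie_mult_scale_left)
    next
      case False
      then have "?t w j = act_list c (bs'[j := bs' ! j \<lhd> b, i' := w])" for w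
        by (metis list_update_swap nth_list_update_neq)
      then show ?thesis
        using IH[of "bs'[j := bs' ! j \<lhd> b]" i'] i' bs by simp
    qed
    then have "(\<Sum>j<n. ?t (prelie_scale r x + y) j) = (\<Sum>j<n. prelie_scale r (?t x j) + ?t y j)"
      by (intro sum.cong) auto
    moreover have "?z (prelie_scale r x + y) = prelie_scale r (?z x) + ?z y"
      using IH i' bs by simp
    ultimately show ?thesis
      by (simp add: Suc bs prelie_mult_add_left prelie_mult_scale_left sum.distrib
          L.scale_sum_right L.scale_right_diff_distrib algebra_simps)
  qed
qed simp

lemma act_list_add:
  "i < length bs \<Longrightarrow> act_list c (bs[i := x + y]) = act_list c (bs[i := x]) + act_list c (bs[i := y])"
  using act_list_linear[of i bs c 1 x y] by simp

lemma act_list_zero: "i < length bs \<Longrightarrow> act_list c (bs[i := 0]) = 0"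
  using act_list_add[of i bs c 0 0] by simp

lemma act_list_scale:
  "i < length bs \<Longrightarrow> act_list c (bs[i := prelie_scale r x]) = prelie_scale r (act_list c (bs[i := x]))"
  using act_list_linear[of i bs c r x 0] by (simp add: act_list_zero)

lemma act_list_swap: "act_list c (b # d # bs) = act_list c (d # b # bs)"
proof -
  let ?n = "length bs"
  let ?A = "act_list c"
  let ?U = "\<lambda>b. \<Sum>i<?n. ?A (bs[i := bs ! i \<lhd> b])"
  let ?T = "\<lambda>b d i j. ?A (bs[i := bs ! i \<lhd> b, j := bs[i := bs ! i \<lhd> b] ! j \<lhd> d])"
  let ?D = "\<lambda>b d. \<Sum>i<?n. \<Sum>j\<in>{..<?n} - {i}. ?T b d i j"
  let ?E = "\<lambda>b d. \<Sum>i<?n. ?A (bs[i := bs ! i \<lhd> b \<lhd> d]) + ?A (bs[i := bs ! i \<lhd> (d \<lhd> b)])"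
  have T: "(\<Sum>i<?n. \<Sum>j<?n. ?T b d i j) = ?D b d + (\<Sum>i<?n. ?A (bs[i := bs ! i \<lhd> b \<lhd> d]))" for b d
  proof -
    have "(\<Sum>j<?n. ?T b d i j) = (\<Sum>j\<in>{..<?n} - {i}. ?T b d i j) + ?A (bs[i := bs ! i \<lhd> b \<lhd> d])"
      if "i < ?n" for i
      using that by (subst sum.remove[of _ i]) (auto simp: add.commute)
    then show ?thesis by (simp add: sum.distrib)
  qed
  have expand: "?A (b # d # bs) = (?A bs \<lhd> d \<lhd> b - ?A bs \<lhd> (d \<lhd> b))
      - (\<Sum>i<?n. ?A (bs[i := bs ! i \<lhd> d])) \<lhd> b - (\<Sum>i<?n. ?A (bs[i := bs ! i \<lhd> b])) \<lhd> d
      + (?D b d + ?E b d)" for b d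
    using T[of b d]
    by (simp add: sum.lessThan_Suc_shift prelie_mult_diff_left prelie_mult_sum_left sum.distrib
        sum_subtractf algebra_simps del: sum.lessThan_Suc)
  have D: "?D b d = ?D d b"
  proof -
    define t where "t b d i j = ?T b d i j" for b d i j
    have "t b d i j = t d b j i" if "i \<noteq> j" for i j
      using that unfolding t_def by (simp add: list_update_swap)
    note tt = this
    have "(\<Sum>(i, j)\<in>(SIGMA i:{..<?n}. {..<?n} - {i}). t b d i j) =
        (\<Sum>(i, j)\<in>(SIGMA i:{..<?n}. {..<?n} - {i}). t d b i j)"
      by (intro sum.reindex_bij_witness[where i = "\<lambda>(i, j). (j, i)" and j = "\<lambda>(i, j). (j, i)"])
        (auto, metis tt)
    then show ?thesis unfolding t_def[symmetric] by (simp add: sum.Sigma)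
  qed
  have E: "?E b d = ?E d b"
  proof (rule sum.cong)
    fix i assume "i \<in> {..<?n}"
    then have i: "i < ?n" by simp
    have "x \<lhd> b \<lhd> d + x \<lhd> (d \<lhd> b) = x \<lhd> d \<lhd> b + x \<lhd> (b \<lhd> d)" for x
      using prelie_identity[of x b d] by (simp add: algebra_simps)
    then show "?A (bs[i := bs ! i \<lhd> b \<lhd> d]) + ?A (bs[i := bs ! i \<lhd> (d \<lhd> b)]) =
        ?A (bs[i := bs ! i \<lhd> d \<lhd> b]) + ?A (bs[i := bs ! i \<lhd> (b \<lhd> d)])"
      by (simp add: act_list_add[OF i, symmetric])
  qed simp
  have I: "?A bs \<lhd> d \<lhd> b - ?A bs \<lhd> (d \<lhd> b) = ?A bs \<lhd> b \<lhd> d - ?A bs \<lhd> (b \<lhd> d)"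
    by (rule prelie_identity)
  show ?thesis unfolding expand D E I by (simp add: algebra_simps)
qed

lemma sum_nth_mset:
  "(\<Sum>i<length xs. h (xs ! i)) = (\<Sum>x\<in>#mset xs. h x :: 'b::comm_monoid_add)"
proof -
  have "(\<Sum>x\<in>#mset xs. h x) = sum_list (map h xs)" by (metis mset_map sum_mset_sum_list)
  then show ?thesis by (simp add: sum_list_sum_nth atLeast0LessThan)
qed

lemma act_list_mset: "mset bs = mset bs' \<Longrightarrow> act_list c bs = act_list c bs'"
proof (induction "length bs" arbitrary: bs bs')
  case (Suc n)
  have IH: "act_list c xs = act_list c ys" if "mset xs = mset ys" "length xs = n" for xs ys
    using Suc.hyps(1)[of xs ys] that by auto
  have cons: "act_list c (b # xs) = act_list c (b # ys)"
    if eq: "mset xs = mset ys" and len: "length xs = n" for b xs ys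
  proof -
    define g where "g M = act_list c (SOME zs. mset zs = M)" for M
    have g: "act_list c zs = g (mset zs)" if "length zs = n" for zs
      unfolding g_def using that by (intro IH) (metis (mono_tags) someI, simp)
    have "(\<Sum>i<length zs. act_list c (zs[i := zs ! i \<lhd> b])) =
        (\<Sum>x\<in>#mset zs. g (add_mset (x \<lhd> b) (mset zs - {#x#})))" if "length zs = n" for zs
      unfolding sum_nth_mset[symmetric] using that
      by (intro sum.cong) (auto simp: g mset_update)
    moreover have "length ys = n" using eq len by (metis size_mset)
    ultimately show ?thesis using eq len IH[OF eq len] by simp
  qed
  from Suc obtain b xs where bs: "bs = b # xs" "length xs = n" by (cases bs) auto
  from Suc bs obtain d ys where bs': "bs' = d # ys" by (cases bs') auto
  have len: "length ys = n" using Suc.prems bs bs' by (metis length_Cons nat.inject size_mset)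
  show ?case
  proof (cases "b = d")
    case True
    then show ?thesis using cons[of xs ys b] bs bs' Suc.prems by simp
  next
    case False
    then have "d \<in># mset xs" using Suc.prems bs bs'
      by (metis insert_noteq_member mset.simps(2))
    then obtain M where M: "mset xs = add_mset d M" by (metis mset_add)
    then have M': "mset ys = add_mset b M" using Suc.prems bs bs' by (simp add: add_mset_commute)
    obtain zs where "mset zs = M" by (metis ex_mset)
    then have "act_list c (b # xs) = act_list c (b # d # zs)" "act_list c (d # ys) = act_list c (d # b # zs)"
      using cons[of xs "d # zs" b] cons[of ys "b # zs" d] M M' bs len by simp_all
    then show ?thesis using bs bs' act_list_swap by metis
  qed
qed simp

definition list_of :: "'a multiset \<Rightarrow> 'a list" where
  "list_of M = (SOME xs. mset xs = M)"

lemma mset_list_of [simp]: "mset (list_of M) = M"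
  unfolding list_of_def by (rule someI_ex) (rule ex_mset)

lemma act_list_list_of_add_mset:
  "act_list c (list_of (add_mset x M)) = act_list c (x # list_of M)"
  by (rule act_list_mset) simp

lift_definition act :: "'k::field prelie \<Rightarrow> 'k symalg \<Rightarrow> 'k prelie" (infixl \<open>\<lhd>\<^sub>S\<close> 75)
  is "\<lambda>c. lin_ext prelie_scale (\<lambda>M. act_list c (list_of M))"
proof -
  fix c :: "'k prelie" and p q assume "sym_rel p (q :: 'k prelie multiset \<Rightarrow>\<^sub>0 'k)"
  then have "lin_ext prelie_scale (\<lambda>M. act_list c (list_of M)) (p - q) = 0"
    using act_list_add[of 0 "_ # _"] act_list_scale[of 0 "_ # _"]
    by (intro lin_ext_sym_ideal[OF L.module_axioms])
      (simp_all add: sym_rel_def act_list_list_of_add_mset del: act_list.simps)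
  then show "lin_ext prelie_scale (\<lambda>M. act_list c (list_of M)) p =
      lin_ext prelie_scale (\<lambda>M. act_list c (list_of M)) q"
    by (simp add: L.lin_ext_diff)
qed

lemma act_mon: "c \<lhd>\<^sub>S mon (mset bs) = act_list c bs"
  unfolding mon_def act.abs_eq by (simp add: act_list_mset[of "list_of (mset bs)" bs])

lemma act_prod_list: "c \<lhd>\<^sub>S prod_list (map emb bs) = act_list c bs"
  by (metis act_mon mon_mset)

lemma act_add_right: "c \<lhd>\<^sub>S (u + v) = c \<lhd>\<^sub>S u + c \<lhd>\<^sub>S v"
  by transfer (simp add: L.lin_ext_add)

lemma act_scale_right: "c \<lhd>\<^sub>S sym_scale r u = prelie_scale r (c \<lhd>\<^sub>S u)"
  by transfer (simp add: L.lin_ext_scale)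

lemma act_one: "c \<lhd>\<^sub>S 1 = c"
  using act_prod_list[of c "[]"] by simp

lemma act_emb: "c \<lhd>\<^sub>S emb b = c \<lhd> b"
  using act_prod_list[of c "[b]"] by simp

lemma act_prod_snoc:
  "c \<lhd>\<^sub>S (prod_list (map emb bs) * emb b) =
    (c \<lhd>\<^sub>S prod_list (map emb bs)) \<lhd> b -
    (\<Sum>i<length bs. c \<lhd>\<^sub>S prod_list (map emb (bs[i := bs ! i \<lhd> b])))"
  using act_prod_list[of c "b # bs"] by (simp add: act_prod_list mult.commute)

lemma act_list_add_left: "act_list (c + c') bs = act_list c bs + act_list c' bs"
  by (induction "c + c'" bs rule: act_list.induct)
    (simp_all add: prelie_mult_add_left sum.distrib algebra_simps)

lemma act_list_scale_left: "act_list (prelie_scale r c) bs = prelie_scale r (act_list c bs)"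
  by (induction "prelie_scale r c" bs rule: act_list.induct)
    (simp_all add: prelie_mult_scale_left L.scale_sum_right L.scale_right_diff_distrib)

lemma act_add_left: "(c + c') \<lhd>\<^sub>S u = c \<lhd>\<^sub>S u + c' \<lhd>\<^sub>S u"
  by transfer (simp add: act_list_add_left lin_ext_fun_add[OF L.module_axioms])

lemma act_scale_left: "prelie_scale r c \<lhd>\<^sub>S u = prelie_scale r (c \<lhd>\<^sub>S u)"
  by transfer (simp add: act_list_scale_left lin_ext_fun_scale[OF L.module_axioms])

section \<open>The product of the enveloping algebra\<close>

text \<open>
  \<open>fibre_prod bs f i\<close> is \<open>B\<^sub>i\<close>. Lists are indexed from 0, so \<open>as ! i\<close> is the
  factor \<open>a\<^sub>i\<^sub>+\<^sub>1\<close> and is acted on by the fibre over \<open>Suc i\<close>; the fibre over 0 is the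
  factor \<open>B\<^sub>0\<close>. See \<open>star_prod_list\<close> for the product on \<open>S(L)\<close>.
\<close>

definition fibre_prod :: "'k::field prelie list \<Rightarrow> (nat \<Rightarrow> nat) \<Rightarrow> nat \<Rightarrow> 'k symalg" where
  "fibre_prod bs f i = (\<Prod>j | j < length bs \<and> f j = i. emb (bs ! j))"

definition star_term :: "'k::field prelie list \<Rightarrow> 'k prelie list \<Rightarrow> (nat \<Rightarrow> nat) \<Rightarrow> 'k symalg" where
  "star_term as bs f =
    fibre_prod bs f 0 * (\<Prod>i<length as. emb (as ! i \<lhd>\<^sub>S fibre_prod bs f (Suc i)))"

definition star_list :: "'k::field prelie list \<Rightarrow> 'k prelie list \<Rightarrow> 'k symalg" where
  "star_list as bs = (\<Sum>f\<in>{..<length bs} \<rightarrow>\<^sub>E {..length as}. star_term as bs f)"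

lemma fibre_prod_cong:
  "(\<And>j. j < length bs \<Longrightarrow> f j = i \<longleftrightarrow> g j = i') \<Longrightarrow> fibre_prod bs f i = fibre_prod bs g i'"
  unfolding fibre_prod_def by (intro prod.cong) auto

lemma fibre_prod_permute:
  assumes "p permutes {..<length bs}"
  shows "fibre_prod (permute_list p bs) (f \<circ> p) i = fibre_prod bs f i"
proof -
  have "p j < length bs \<longleftrightarrow> j < length bs" for j
    using permutes_in_image[OF assms, of j] by simp
  moreover have "inv p j < length bs \<longleftrightarrow> j < length bs" for j
    using permutes_in_image[OF permutes_inv[OF assms], of j] by simp
  ultimately show ?thesis unfolding fibre_prod_def
    by (intro prod.reindex_bij_witness[where i = "inv p" and j = p])
      (auto simp: permute_list_nth[OF assms] permutes_inverses[OF assms])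
qed

lemma star_list_mset_right:
  assumes "mset bs = mset bs'"
  shows "star_list as bs = star_list as bs'"
proof -
  obtain p where p: "p permutes {..<length bs'}" "permute_list p bs' = bs"
    using mset_eq_permutation[OF assms] .
  then have [simp]: "length bs = length bs'" by auto
  have T: "star_term as bs (f \<circ> p) = star_term as bs' f" for f
    unfolding star_term_def p(2)[symmetric] fibre_prod_permute[OF p(1)] by simp
  have p': "inv p permutes {..<length bs'}" using p(1) by (rule permutes_inv)
  have PiE: "f \<circ> q \<in> {..<length bs'} \<rightarrow>\<^sub>E {..length as}"
    if "f \<in> {..<length bs'} \<rightarrow>\<^sub>E {..length as}" "q permutes {..<length bs'}" for f q
    using that permutes_in_image[OF that(2)] permutes_not_in[OF that(2)]
    by (fastforce simp: PiE_iff extensional_def)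
  show ?thesis unfolding star_list_def
    by (rule sum.reindex_bij_witness[where i = "\<lambda>f. f \<circ> p" and j = "\<lambda>f. f \<circ> inv p"])
      (use PiE p(1) p' T in \<open>auto simp: comp_assoc permutes_inv_o[OF p(1)] simp flip: T\<close>)
qed

lemma star_list_mset_left:
  assumes "mset as = mset as'"
  shows "star_list as bs = star_list as' bs"
proof -
  obtain p where p: "p permutes {..<length as'}" "permute_list p as' = as"
    using mset_eq_permutation[OF assms] .
  then have [simp]: "length as = length as'" by auto
  let ?l = "length as'" and ?m = "length bs"
  define P where "P q f = restrict (\<lambda>j. case f j of 0 \<Rightarrow> 0 | Suc i \<Rightarrow> Suc (q i)) {..<?m}"
    for q :: "nat \<Rightarrow> nat" and f :: "nat \<Rightarrow> nat"
  have p': "inv p permutes {..<?l}" using p(1) by (rule permutes_inv)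
  have lt: "p i < ?l \<longleftrightarrow> i < ?l" "inv p i < ?l \<longleftrightarrow> i < ?l" for i
    using permutes_in_image[OF p(1), of i] permutes_in_image[OF p', of i] by simp_all
  have P: "P q f \<in> {..<?m} \<rightarrow>\<^sub>E {..?l}"
    if "f \<in> {..<?m} \<rightarrow>\<^sub>E {..?l}" "\<And>i. i < ?l \<Longrightarrow> q i < ?l" for q f
    unfolding P_def
  proof (rule restrict_PiE_iff[THEN iffD2], intro ballI)
    fix j assume "j \<in> {..<?m}"
    then have "f j \<le> ?l" using that(1) by auto
    then show "(case f j of 0 \<Rightarrow> 0 | Suc i \<Rightarrow> Suc (q i)) \<in> {..?l}"
      using that(2) by (auto split: nat.split simp: Suc_le_eq)
  qed
  have PP: "P q (P r f) = f" if "f \<in> {..<?m} \<rightarrow>\<^sub>E {..?l}" "\<And>i. q (r i) = i" for q r f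
  proof
    fix j
    show "P q (P r f) j = f j"
      using that by (cases "j < ?m") (auto simp: P_def PiE_iff extensional_def split: nat.split)
  qed
  have T: "star_term as' bs (P p f) = star_term as bs f" for f
  proof -
    have "fibre_prod bs (P p f) 0 = fibre_prod bs f 0"
      by (rule fibre_prod_cong) (auto simp: P_def split: nat.split)
    moreover have "fibre_prod bs (P p f) (Suc (p i)) = fibre_prod bs f (Suc i)" for i
      by (rule fibre_prod_cong) (auto simp: P_def permutes_inj[OF p(1), THEN inj_eq] split: nat.split)
    then have "(\<Prod>i<?l. emb (as ! i \<lhd>\<^sub>S fibre_prod bs f (Suc i))) =
        (\<Prod>i<?l. emb (as' ! i \<lhd>\<^sub>S fibre_prod bs (P p f) (Suc i)))"
      by (intro prod.reindex_bij_witness[where i = "inv p" and j = p])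
        (auto simp: p(2)[symmetric] permute_list_nth[OF p(1)] lt permutes_inverses[OF p(1)])
    ultimately show ?thesis by (simp add: star_term_def)
  qed
  show ?thesis unfolding star_list_def
    by (rule sum.reindex_bij_witness[where i = "P (inv p)" and j = "P p"])
      (auto simp: P PP T lt permutes_inverses[OF p(1)])
qed

lemma star_list_linear_left:
  "star_list ((prelie_scale r x + y) # as) bs =
    sym_scale r (star_list (x # as) bs) + star_list (y # as) bs"
  by (simp add: star_list_def star_term_def prod.lessThan_Suc_shift act_add_left act_scale_left
      emb_add emb_scale sym_scale_mult_left sym_scale_mult_right S.scale_sum_right distrib_left
      distrib_right sum.distrib del: prod.lessThan_Suc)

lemma fibre_prod_Cons:
  "fibre_prod (b # bs) f i = (if f 0 = i then emb b else 1) * fibre_prod bs (f \<circ> Suc) i"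
proof -
  have *: "{j. j < length (b # bs) \<and> f j = i} =
      (if f 0 = i then {0} else {}) \<union> Suc ` {j. j < length bs \<and> f (Suc j) = i}"
    by (auto simp: less_Suc_eq_0_disj)
  show ?thesis
    unfolding fibre_prod_def *
    by (subst prod.union_disjoint) (auto simp: prod.reindex)
qed

lemma star_term_linear_right:
  assumes "f 0 \<le> length as"
  shows "star_term as ((prelie_scale r x + y) # bs) f =
    sym_scale r (star_term as (x # bs) f) + star_term as (y # bs) f"
proof (cases "f 0")
  case 0
  then show ?thesis
    by (simp add: star_term_def fibre_prod_Cons emb_add emb_scale distrib_left distrib_right
        sym_scale_mult_left sym_scale_mult_right)
next
  case (Suc k)
  then have k: "k \<in> {..<length as}" using assms by auto
  have *: "star_term as (z # bs) f = fibre_prod bs (f \<circ> Suc) 0 *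
      (emb (as ! k \<lhd>\<^sub>S (emb z * fibre_prod bs (f \<circ> Suc) (Suc k))) *
      (\<Prod>i\<in>{..<length as} - {k}. emb (as ! i \<lhd>\<^sub>S fibre_prod bs (f \<circ> Suc) (Suc i))))" for z
    unfolding star_term_def using Suc
    by (subst prod.remove[OF _ k]) (auto simp: fibre_prod_Cons intro!: prod.cong)
  show ?thesis unfolding *
    by (simp add: emb_add emb_scale distrib_left distrib_right act_add_right act_scale_right
        sym_scale_mult_left sym_scale_mult_right)
qed

lemma star_list_linear_right:
  "star_list as ((prelie_scale r x + y) # bs) =
    sym_scale r (star_list as (x # bs)) + star_list as (y # bs)"
proof -
  have "star_list as ((prelie_scale r x + y) # bs) =
      (\<Sum>f\<in>{..<length (x # bs)} \<rightarrow>\<^sub>E {..length as}.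
        sym_scale r (star_term as (x # bs) f) + star_term as (y # bs) f)"
    unfolding star_list_def by (intro sum.cong star_term_linear_right) auto
  then show ?thesis by (simp add: star_list_def sum.distrib S.scale_sum_right)
qed

definition sym_lift :: "('k::field prelie list \<Rightarrow> 'k symalg) \<Rightarrow> ('k prelie multiset \<Rightarrow>\<^sub>0 'k) \<Rightarrow> 'k symalg" where
  "sym_lift F = lin_ext sym_scale (\<lambda>M. F (list_of M))"

definition sym_multilinear :: "('k::field prelie list \<Rightarrow> 'k symalg) \<Rightarrow> bool" where
  "sym_multilinear F \<longleftrightarrow> (\<forall>xs ys. mset xs = mset ys \<longrightarrow> F xs = F ys) \<and>
    (\<forall>r x y xs. F ((prelie_scale r x + y) # xs) = sym_scale r (F (x # xs)) + F (y # xs))"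

lemma sym_multilinearD:
  assumes "sym_multilinear F"
  shows "mset xs = mset ys \<Longrightarrow> F xs = F ys"
    and "F ((x + y) # xs) = F (x # xs) + F (y # xs)"
    and "F (prelie_scale r x # xs) = sym_scale r (F (x # xs))"
proof -
  have lin: "F ((prelie_scale r x + y) # xs) = sym_scale r (F (x # xs)) + F (y # xs)" for r x y xs
    using assms by (simp add: sym_multilinear_def)
  show add: "F ((x + y) # xs) = F (x # xs) + F (y # xs)" for x y xs using lin[of 1 x y xs] by simp
  have "F (0 # xs) = 0" using add[of 0 0 xs] by simp
  then show "F (prelie_scale r x # xs) = sym_scale r (F (x # xs))" using lin[of r x 0 xs] by simp
  show "mset xs = mset ys \<Longrightarrow> F xs = F ys"
    using assms unfolding sym_multilinear_def by blast
qed

lemma sym_lift_respects: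
  assumes "sym_multilinear F" "sym_rel p q"
  shows "sym_lift F p = sym_lift F q"
proof -
  have *: "F (list_of (add_mset x M)) = F (x # list_of M)" for x M
    by (rule sym_multilinearD(1)[OF assms(1)]) simp
  have "sym_lift F (p - q) = 0"
    unfolding sym_lift_def using assms(2)
    by (intro lin_ext_sym_ideal[OF S.module_axioms])
      (simp_all add: * sym_rel_def sym_multilinearD(2,3)[OF assms(1)])
  then show ?thesis by (simp add: sym_lift_def S.lin_ext_diff)
qed

lemma sym_lift_single:
  "sym_multilinear F \<Longrightarrow> sym_lift F (Poly_Mapping.single (mset xs) 1) = F xs"
  by (simp add: sym_lift_def sym_multilinearD(1)[of F "list_of (mset xs)" xs])

lemma sym_multilinear_star_left: "sym_multilinear (\<lambda>as. star_list as bs)"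
  using star_list_mset_left by (auto simp: sym_multilinear_def star_list_linear_left)

lemma sym_multilinear_star_right: "sym_multilinear (star_list as)"
  using star_list_mset_right by (auto simp: sym_multilinear_def star_list_linear_right)

lemma sym_lift_fun_linear:
  "sym_lift (\<lambda>as. sym_scale r (F as) + G as) p = sym_scale r (sym_lift F p) + sym_lift G p"
  by (simp add: sym_lift_def lin_ext_fun_add[OF S.module_axioms] lin_ext_fun_scale[OF S.module_axioms])

lemma sym_multilinear_star_lift: "sym_multilinear (\<lambda>as. sym_lift (star_list as) q)"
  unfolding sym_multilinear_def
proof (intro conjI allI impI)
  fix xs ys :: "'a prelie list" assume "mset xs = mset ys"
  then have "star_list xs = star_list ys" using star_list_mset_left by blast
  then show "sym_lift (star_list xs) q = sym_lift (star_list ys) q" by simp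
next
  fix r and x y :: "'a prelie" and xs
  have "star_list ((prelie_scale r x + y) # xs) =
      (\<lambda>bs. sym_scale r (star_list (x # xs) bs) + star_list (y # xs) bs)"
    by (rule ext) (rule star_list_linear_left)
  then show "sym_lift (star_list ((prelie_scale r x + y) # xs)) q =
      sym_scale r (sym_lift (star_list (x # xs)) q) + sym_lift (star_list (y # xs)) q"
    by (simp add: sym_lift_fun_linear)
qed

lift_definition star :: "'k::field symalg \<Rightarrow> 'k symalg \<Rightarrow> 'k symalg" (infixl \<open>\<star>\<close> 70)
  is "\<lambda>p q. sym_lift (\<lambda>as. sym_lift (star_list as) q) p"
proof -
  fix p p' q q' :: "'k prelie multiset \<Rightarrow>\<^sub>0 'k"
  assume "sym_rel p p'" "sym_rel q q'"
  moreover have "sym_lift (star_list as) q = sym_lift (star_list as) q'" for as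
    using \<open>sym_rel q q'\<close> by (rule sym_lift_respects[OF sym_multilinear_star_right])
  ultimately show "sym_lift (\<lambda>as. sym_lift (star_list as) q) p =
      sym_lift (\<lambda>as. sym_lift (star_list as) q') p'"
    by (simp add: sym_lift_respects[OF sym_multilinear_star_lift])
qed

lemma star_prod_list:
  "prod_list (map emb as) \<star> prod_list (map emb bs) = star_list as bs"
  by (simp add: mon_mset[symmetric] mon_def star.abs_eq
      sym_lift_single[OF sym_multilinear_star_right] sym_lift_single[OF sym_multilinear_star_lift]
      sym_lift_single[OF sym_multilinear_star_left])

lemma sym_lift_add: "sym_lift F (p + q) = sym_lift F p + sym_lift F q"
  by (simp add: sym_lift_def S.lin_ext_add)

lemma sym_lift_scale: "sym_lift F (pm_scale c p) = sym_scale c (sym_lift F p)"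
  by (simp add: sym_lift_def S.lin_ext_scale)

lemma star_add_left: "(u + v) \<star> w = u \<star> w + v \<star> w"
  by transfer (simp add: sym_lift_add)

lemma star_scale_left: "sym_scale c u \<star> v = sym_scale c (u \<star> v)"
  by transfer (simp add: sym_lift_scale)

lemma star_add_right: "u \<star> (v + w) = u \<star> v + u \<star> w"
  by transfer (simp add: sym_lift_add, simp add: sym_lift_def lin_ext_fun_add[OF S.module_axioms])

lemma star_scale_right: "u \<star> sym_scale c v = sym_scale c (u \<star> v)"
  by transfer (simp add: sym_lift_scale, simp add: sym_lift_def lin_ext_fun_scale[OF S.module_axioms])

section \<open>The PBW isomorphism and the projection onto primitive elements\<close>

definition star_prod :: "'k::field prelie list \<Rightarrow> 'k symalg" where
  "star_prod ls = foldr (\<star>) (map emb ls) 1"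

definition pbw_list :: "'k::field_char_0 prelie list \<Rightarrow> 'k symalg" where
  "pbw_list ls = sym_scale (1 / fact (length ls))
    (\<Sum>\<sigma> | \<sigma> permutes {..<length ls}. star_prod (permute_list \<sigma> ls))"

lemma star_prod_linear:
  "i < length ls \<Longrightarrow> star_prod (ls[i := prelie_scale r x + y]) =
    sym_scale r (star_prod (ls[i := x])) + star_prod (ls[i := y])"
proof (induction ls arbitrary: i)
  case (Cons l ls)
  then show ?case
    by (cases i) (simp_all add: star_prod_def emb_add emb_scale star_add_left star_add_right
        star_scale_left star_scale_right)
qed simp

lemma permute_list_update:
  assumes "\<sigma> permutes {..<length ls}" "i < length ls"
  shows "permute_list \<sigma> (ls[i := x]) = (permute_list \<sigma> ls)[inv \<sigma> i := x]"
proof (rule nth_equalityI)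
  fix j assume "j < length (permute_list \<sigma> (ls[i := x]))"
  then have j: "j < length ls" by simp
  then have "\<sigma> j < length ls" using permutes_in_image[OF assms(1), of j] by simp
  moreover have "inv \<sigma> i = j \<longleftrightarrow> i = \<sigma> j" using permutes_inverses[OF assms(1)] by metis
  ultimately show "permute_list \<sigma> (ls[i := x]) ! j = (permute_list \<sigma> ls)[inv \<sigma> i := x] ! j"
    using assms j by (auto simp: permute_list_nth nth_list_update)
qed simp

lemma sym_multilinear_pbw: "sym_multilinear pbw_list"
  unfolding sym_multilinear_def
proof (intro conjI allI impI)
  fix xs ys :: "'a prelie list" assume "mset xs = mset ys"
  then obtain p where p: "p permutes {..<length ys}" "permute_list p ys = xs"
    by (rule mset_eq_permutation)
  have "(\<Sum>\<sigma> | \<sigma> permutes {..<length ys}. star_prod (permute_list \<sigma> (permute_list p ys))) =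
      (\<Sum>\<sigma> | \<sigma> permutes {..<length ys}. star_prod (permute_list (p \<circ> \<sigma>) ys))"
    by (intro sum.cong) (simp_all add: permute_list_compose[OF p(1)] permute_list_compose)
  also have "\<dots> = (\<Sum>\<sigma> | \<sigma> permutes {..<length ys}. star_prod (permute_list \<sigma> ys))"
    by (rule setum_permutations_compose_left[OF p(1), symmetric])
  finally show "pbw_list xs = pbw_list ys"
    by (simp add: pbw_list_def flip: p(2))
next
  fix r and x y :: "'a prelie" and ls
  let ?P = "{\<sigma>. \<sigma> permutes {..<length (x # ls)}}"
  have "star_prod (permute_list \<sigma> ((prelie_scale r x + y) # ls)) =
      sym_scale r (star_prod (permute_list \<sigma> (x # ls))) + star_prod (permute_list \<sigma> (y # ls))"
    if "\<sigma> \<in> ?P" for \<sigma>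
  proof -
    have \<sigma>: "\<sigma> permutes {..<length (x # ls)}" using that by simp
    have "permute_list \<sigma> (z # ls) = (permute_list \<sigma> (x # ls))[inv \<sigma> 0 := z]" for z
      using permute_list_update[OF \<sigma>, of 0 z] by simp
    moreover have "inv \<sigma> 0 < length (permute_list \<sigma> (x # ls))"
      using permutes_in_image[OF permutes_inv[OF \<sigma>], of 0] by simp
    ultimately show ?thesis
      using star_prod_linear[of "inv \<sigma> 0" "permute_list \<sigma> (x # ls)" r x y] by metis
  qed
  then have "(\<Sum>\<sigma>\<in>?P. star_prod (permute_list \<sigma> ((prelie_scale r x + y) # ls))) =
      (\<Sum>\<sigma>\<in>?P. sym_scale r (star_prod (permute_list \<sigma> (x # ls))) + star_prod (permute_list \<sigma> (y # ls)))"
    by (rule sum.cong[OF refl])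
  then show "pbw_list ((prelie_scale r x + y) # ls) =
      sym_scale r (pbw_list (x # ls)) + pbw_list (y # ls)"
    by (simp add: pbw_list_def sum.distrib S.scale_right_distrib S.scale_sum_right mult.commute)
qed

lift_definition pbw :: "'k::field_char_0 symalg \<Rightarrow> 'k symalg" is "sym_lift pbw_list"
  by (rule sym_lift_respects[OF sym_multilinear_pbw])

lemma pbw_prod_list: "pbw (prod_list (map emb ls)) = pbw_list ls"
  by (simp add: mon_mset[symmetric] mon_def pbw.abs_eq sym_lift_single[OF sym_multilinear_pbw])

lemma pbw_add: "pbw (u + v) = pbw u + pbw v"
  by transfer (simp add: sym_lift_add)

lemma pbw_scale: "pbw (sym_scale c u) = sym_scale c (pbw u)"
  by transfer (simp add: sym_lift_scale)

definition sym_power :: "nat \<Rightarrow> 'k::field symalg set" where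
  "sym_power i = S.span {prod_list (map emb xs) | xs. length xs = i}"

definition pbw_component :: "nat \<Rightarrow> 'k::field_char_0 symalg set" where
  "pbw_component i = pbw ` sym_power i"

text \<open>
  The component \<open>P\<^sub>1\<close> is \<open>range emb\<close> and is identified with \<open>L\<close>. The projection is well
  defined by \<open>sol1_ex1\<close>.
\<close>

definition sol1 :: "'k::field_char_0 symalg \<Rightarrow> 'k prelie" where
  "sol1 u = (THE x. u - emb x \<in> S.span (\<Union>j\<in>- {1}. pbw_component j))"

lemma emb_0: "emb 0 = 0"
  using emb_scale[of 0 0] by simp

definition sym_filtration :: "nat \<Rightarrow> 'k::field symalg set" where
  "sym_filtration n = S.span {prod_list (map emb xs) | xs. length xs \<le> n}"

lemma sym_filtration_subspace: "S.subspace (sym_filtration n)"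
  unfolding sym_filtration_def by (rule S.subspace_span)

lemmas sym_filtration_closed =
  S.subspace_0[OF sym_filtration_subspace] S.subspace_add[OF sym_filtration_subspace]
  S.subspace_diff[OF sym_filtration_subspace] S.subspace_scale[OF sym_filtration_subspace]
  S.subspace_sum[OF sym_filtration_subspace]

lemma prod_list_filtration: "length xs \<le> n \<Longrightarrow> prod_list (map emb xs) \<in> sym_filtration n"
  unfolding sym_filtration_def by (rule S.span_base) auto

lemma sym_filtration_mono: "m \<le> n \<Longrightarrow> u \<in> sym_filtration m \<Longrightarrow> u \<in> sym_filtration n"
  unfolding sym_filtration_def by (erule rev_subsetD) (intro S.span_mono, auto)

lemma sym_power_filtration: "u \<in> sym_power n \<Longrightarrow> u \<in> sym_filtration n"
  unfolding sym_filtration_def sym_power_def by (erule rev_subsetD) (intro S.span_mono, auto)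

lemma sym_filtration_exhaust: "\<exists>n. u \<in> sym_filtration n"
proof (induction u rule: sym_induct)
  case zero
  show ?case by (simp add: sym_filtration_closed)
next
  case (add c M u)
  then obtain n where "u \<in> sym_filtration n" by auto
  then have "u \<in> sym_filtration (max n (size M))"
    by (rule sym_filtration_mono[rotated]) simp
  moreover have "mon M \<in> sym_filtration (max n (size M))"
    using prod_list_filtration[of "list_of M"] by (simp add: mon_mset[symmetric] flip: size_mset)
  ultimately show ?case by (auto intro: sym_filtration_closed)
qed

lemma emb_mult_filtration: "u \<in> sym_filtration n \<Longrightarrow> emb x * u \<in> sym_filtration (Suc n)"
  unfolding sym_filtration_def[of n]
proof (induction rule: S.span_induct_alt)
  case (step c v w)
  then obtain xs where "v = prod_list (map emb xs)" "length xs \<le> n" by auto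
  then show ?case using step prod_list_filtration[of "x # xs" "Suc n"]
    by (auto simp: distrib_left sym_scale_mult_right intro!: sym_filtration_closed)
qed (simp add: sym_filtration_closed)

lemma fibre_prod_filtration:
  assumes "card {j. j < length bs \<and> f j = i} \<le> n"
  shows "fibre_prod bs f i \<in> sym_filtration n"
proof -
  have "(\<Prod>j\<in>A. emb (bs ! j)) \<in> sym_filtration (card A)" if "finite A" for A
    using that
  proof (induction A rule: finite_induct)
    case empty
    show ?case using prod_list_filtration[of "[]" 0] by simp
  qed (simp add: emb_mult_filtration)
  then have "fibre_prod bs f i \<in> sym_filtration (card {j. j < length bs \<and> f j = i})"
    unfolding fibre_prod_def by auto
  then show ?thesis by (rule sym_filtration_mono[OF assms])
qed

lemma star_list_singleton:
  "star_list [x] bs - emb x * prod_list (map emb bs) \<in> sym_filtration (length bs)"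
proof -
  let ?m = "length bs"
  let ?F = "{..<?m} \<rightarrow>\<^sub>E {..1::nat}"
  let ?f = "\<lambda>j\<in>{..<?m}. 0 :: nat"
  have fin: "finite ?F" by (intro finite_PiE) auto
  have f: "?f \<in> ?F" by auto
  have "fibre_prod bs ?f 0 = prod_list (map emb bs)"
  proof -
    have "{j. j < ?m \<and> ?f j = 0} = {..<?m}" by auto
    then show ?thesis by (simp add: fibre_prod_def prod.list_conv_set_nth atLeast0LessThan)
  qed
  moreover have "fibre_prod bs ?f 1 = 1"
    by (auto simp: fibre_prod_def intro!: prod.neutral)
  ultimately have "star_term [x] bs ?f = emb x * prod_list (map emb bs)"
    by (simp add: star_term_def act_one mult.commute)
  then have "star_list [x] bs - emb x * prod_list (map emb bs) = (\<Sum>f\<in>?F - {?f}. star_term [x] bs f)"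
    using sum.remove[OF fin f, of "star_term [x] bs"] by (simp add: star_list_def)
  moreover have "star_term [x] bs g \<in> sym_filtration ?m" if g: "g \<in> ?F - {?f}" for g
  proof -
    have "\<exists>j<?m. g j \<noteq> 0"
    proof (rule ccontr)
      assume "\<not> ?thesis"
      then have "g j = ?f j" for j using g by (cases "j < ?m") (auto simp: PiE_iff extensional_def)
      then have "g = ?f" by (rule ext)
      then show False using g by simp
    qed
    then obtain k where k: "k < ?m" "g k \<noteq> 0" by blast
    then have "card {j. j < ?m \<and> g j = 0} \<le> card ({..<?m} - {k})"
      by (intro card_mono) auto
    then have "card {j. j < ?m \<and> g j = 0} < ?m" using k by simp
    then obtain n where n: "?m = Suc n" "card {j. j < ?m \<and> g j = 0} \<le> n" by (cases ?m) auto
    show ?thesis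
      using emb_mult_filtration[OF fibre_prod_filtration[OF n(2)]] n(1)
      by (simp add: star_term_def mult.commute[of "fibre_prod bs g 0"])
  qed
  ultimately show ?thesis by (simp only: sym_filtration_closed(5))
qed

lemma star_diff_right: "u \<star> (v - w) = u \<star> v - u \<star> w"
  using star_add_right[of u "v - w" w] by (simp add: algebra_simps)

lemma emb_star_filtration: "u \<in> sym_filtration n \<Longrightarrow> emb x \<star> u - emb x * u \<in> sym_filtration n"
  unfolding sym_filtration_def[of n]
proof (induction rule: S.span_induct_alt)
  case base
  have "emb x \<star> 0 = 0" using star_scale_right[of "emb x" 0 0] by simp
  then show ?case by (simp add: S.span_zero)
next
  case (step c v w)
  then obtain xs where v: "v = prod_list (map emb xs)" "length xs \<le> n" by auto
  have "emb x \<star> v - emb x * v \<in> sym_filtration n"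
    using star_list_singleton[of x xs] star_prod_list[of "[x]" xs] v sym_filtration_mono by auto
  moreover have "emb x \<star> (sym_scale c v + w) - emb x * (sym_scale c v + w) =
      sym_scale c (emb x \<star> v - emb x * v) + (emb x \<star> w - emb x * w)"
    by (simp add: star_add_right star_scale_right distrib_left sym_scale_mult_right
        S.scale_right_diff_distrib)
  ultimately show ?case using step
    by (simp add: sym_filtration_closed flip: sym_filtration_def)
qed

lemma star_prod_filtration:
  "star_prod ls - prod_list (map emb ls) \<in> sym_filtration (length ls - 1)"
proof (induction ls)
  case Nil
  show ?case by (simp add: star_prod_def sym_filtration_closed)
next
  case (Cons l ls)
  let ?u = "star_prod ls - prod_list (map emb ls)"
  have u: "?u \<in> sym_filtration (length ls)" by (rule sym_filtration_mono[OF _ Cons]) simp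
  have v: "emb l * ?u \<in> sym_filtration (length ls)"
  proof (cases ls)
    case Nil
    then show ?thesis by (simp add: star_prod_def sym_filtration_closed)
  next
    case (Cons y ys)
    then show ?thesis using emb_mult_filtration[OF Cons.IH] by simp
  qed
  have "star_prod (l # ls) - prod_list (map emb (l # ls)) =
      (emb l \<star> ?u - emb l * ?u) + emb l * ?u
      + (emb l \<star> prod_list (map emb ls) - emb l * prod_list (map emb ls))"
    by (simp add: star_prod_def star_diff_right)
  also have "\<dots> \<in> sym_filtration (length ls)"
    by (rule sym_filtration_closed(2)[OF sym_filtration_closed(2)[OF emb_star_filtration[OF u] v]
        emb_star_filtration[OF prod_list_filtration[OF order.refl]]])
  finally show ?case by simp
qed

lemma pbw_list_filtration:
  fixes ls :: "'k::field_char_0 prelie list"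
  shows "pbw_list ls - prod_list (map emb ls) \<in> sym_filtration (length ls - 1)"
proof -
  let ?P = "{\<sigma>. \<sigma> permutes {..<length ls}}"
  have perm: "prod_list (map emb (permute_list \<sigma> ls)) = prod_list (map emb ls)" if "\<sigma> \<in> ?P" for \<sigma>
    using that mset_permute_list[of \<sigma> ls] by (simp add: mon_mset[symmetric])
  have card: "card ?P = fact (length ls)" by (simp add: card_permutations)
  have "(\<Sum>\<sigma>\<in>?P. prod_list (map emb (permute_list \<sigma> ls))) = sym_scale (of_nat (card ?P)) (prod_list (map emb ls))"
    unfolding S.sum_constant_scale[symmetric] by (intro sum.cong perm) auto
  then have "pbw_list ls - prod_list (map emb ls) = sym_scale (1 / fact (length ls))
      (\<Sum>\<sigma>\<in>?P. star_prod (permute_list \<sigma> ls) - prod_list (map emb (permute_list \<sigma> ls)))"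
    by (simp add: pbw_list_def sum_subtractf S.scale_right_diff_distrib card)
  also have "\<dots> \<in> sym_filtration (length ls - 1)"
    using star_prod_filtration[of "permute_list _ ls"]
    by (intro sym_filtration_closed(4,5)) auto
  finally show ?thesis .
qed

lemma pbw_zero: "pbw 0 = 0"
  using pbw_scale[of 0 0] by simp

lemma pbw_filtration:
  "u \<in> sym_filtration n \<Longrightarrow> pbw u - u \<in> sym_filtration (n - 1)"
  unfolding sym_filtration_def[of n]
proof (induction rule: S.span_induct_alt)
  case base
  show ?case by (simp add: pbw_zero sym_filtration_closed)
next
  case (step c v w)
  then obtain xs where v: "v = prod_list (map emb xs)" "length xs \<le> n" by auto
  have "pbw v - v \<in> sym_filtration (n - 1)"
    using sym_filtration_mono[OF _ pbw_list_filtration[of xs], of "n - 1"] v by (simp add: pbw_prod_list)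
  moreover have "pbw (sym_scale c v + w) - (sym_scale c v + w) =
      sym_scale c (pbw v - v) + (pbw w - w)"
    by (simp add: pbw_add pbw_scale S.scale_right_diff_distrib)
  ultimately show ?case using step sym_filtration_closed(2,4) by metis
qed

lemma pbw_one: "pbw 1 = 1"
  using pbw_prod_list[of "[]"] by (simp add: pbw_list_def star_prod_def)

lemma pbw_emb: "pbw (emb x) = emb x"
proof -
  have "emb x \<star> 1 = emb x"
    using star_prod_list[of "[x]" "[]"] by (simp add: star_list_def star_term_def fibre_prod_def act_one)
  moreover have "{\<sigma>. \<sigma> permutes {..<Suc 0}} = {id}" by (auto simp: lessThan_Suc)
  ultimately have "pbw_list [x] = emb x"
    by (simp add: pbw_list_def star_prod_def)
  then show ?thesis using pbw_prod_list[of "[x]"] by simp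
qed

lemma sym_multilinear_component:
  "sym_multilinear (\<lambda>xs. if length xs = n then prod_list (map emb xs) else 0)"
  unfolding sym_multilinear_def
  by (auto simp: emb_add emb_scale distrib_right sym_scale_mult_left mon_mset[symmetric] dest: mset_eq_length)

lift_definition sym_component :: "nat \<Rightarrow> 'k::field symalg \<Rightarrow> 'k symalg"
  is "\<lambda>n. sym_lift (\<lambda>xs. if length xs = n then prod_list (map emb xs) else 0)"
  by (rule sym_lift_respects[OF sym_multilinear_component])

lemma sym_component_prod_list:
  "sym_component n (prod_list (map emb xs)) = (if length xs = n then prod_list (map emb xs) else 0)"
  unfolding mon_mset[of xs, symmetric] mon_def sym_component.abs_eq
  by (subst sym_lift_single[OF sym_multilinear_component]) (simp add: mon_mset[symmetric] mon_def)

lemma sym_component_add: "sym_component n (u + v) = sym_component n u + sym_component n v"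
  by transfer (simp add: sym_lift_add)

lemma sym_component_scale: "sym_component n (sym_scale c u) = sym_scale c (sym_component n u)"
  by transfer (simp add: sym_lift_scale)

lemma sym_component_zero: "sym_component n 0 = 0"
  using sym_component_scale[of n 0 0] by simp

lemma sym_component_filtration_less: "u \<in> sym_filtration m \<Longrightarrow> m < n \<Longrightarrow> sym_component n u = 0"
  unfolding sym_filtration_def
  by (induction rule: S.span_induct_alt)
    (auto simp: sym_component_zero sym_component_add sym_component_scale sym_component_prod_list)

lemma sym_component_power: "u \<in> sym_power m \<Longrightarrow> sym_component n u = (if m = n then u else 0)"
  unfolding sym_power_def
  by (induction rule: S.span_induct_alt)
    (auto simp: sym_component_zero sym_component_add sym_component_scale sym_component_prod_list)

lemma sym_component_in_power: "sym_component n u \<in> sym_power n"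
proof -
  note sub = S.subspace_span[of "{prod_list (map emb xs) | xs. length xs = n}", folded sym_power_def]
  show ?thesis
  proof (induction u rule: sym_induct)
    case zero
    show ?case by (simp add: sym_component_zero S.subspace_0[OF sub])
  next
    case (add c M u)
    have "sym_component n (mon M) \<in> sym_power n"
    proof (cases "length (list_of M) = n")
      case True
      then show ?thesis using sym_component_prod_list[of n "list_of M"]
        by (auto simp: mon_mset[symmetric] sym_power_def intro!: S.span_base exI[of _ "list_of M"])
    next
      case False
      then show ?thesis using sym_component_prod_list[of n "list_of M"]
        by (simp add: mon_mset[symmetric] S.subspace_0[OF sub])
    qed
    then show ?case using add
      by (simp add: sym_component_add sym_component_scale S.subspace_add[OF sub] S.subspace_scale[OF sub])
  qed
qed

lemma sym_component_top:
  assumes "u \<in> sym_filtration n"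
  shows "n = 0 \<Longrightarrow> u = sym_component n u"
    and "u - sym_component n u \<in> sym_filtration (n - 1)"
proof -
  have "u - sym_component n u = 0 \<or> n \<noteq> 0 \<and> u - sym_component n u \<in> sym_filtration (n - 1)"
    using assms unfolding sym_filtration_def[of n]
  proof (induction rule: S.span_induct_alt)
    case base
    show ?case by (simp add: sym_component_zero)
  next
    case (step c v w)
    then obtain xs where v: "v = prod_list (map emb xs)" "length xs \<le> n" by auto
    have "v - sym_component n v = 0 \<or> n \<noteq> 0 \<and> v - sym_component n v \<in> sym_filtration (n - 1)"
      using v prod_list_filtration[of xs "n - 1"] by (auto simp: sym_component_prod_list)
    moreover have *: "sym_scale c v + w - sym_component n (sym_scale c v + w) =
        sym_scale c (v - sym_component n v) + (w - sym_component n w)"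
      by (simp add: sym_component_add sym_component_scale S.scale_right_diff_distrib)
    moreover have "x = 0 \<or> n \<noteq> 0 \<and> x \<in> sym_filtration (n - 1) \<Longrightarrow>
        y = 0 \<or> n \<noteq> 0 \<and> y \<in> sym_filtration (n - 1) \<Longrightarrow>
        sym_scale c x + y = 0 \<or> n \<noteq> 0 \<and> sym_scale c x + y \<in> sym_filtration (n - 1)" for x y
      by (auto simp: sym_filtration_closed)
    ultimately show ?case using step.IH by metis
  qed
  then show "n = 0 \<Longrightarrow> u = sym_component n u" "u - sym_component n u \<in> sym_filtration (n - 1)"
    by (auto simp: sym_filtration_closed)
qed

lemma pbw_injective: "pbw u = 0 \<Longrightarrow> u = 0"
proof -
  have "u \<in> sym_filtration n \<Longrightarrow> pbw u = 0 \<Longrightarrow> u = 0" for n u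
  proof (induction n)
    case 0
    have "u \<in> sym_power 0" by (metis 0(1) sym_component_in_power sym_component_top(1))
    then obtain c where c: "u = sym_scale c 1" by (auto simp: sym_power_def S.span_singleton)
    then have "sym_scale c 1 = 0" using 0(2) by (simp add: pbw_one pbw_scale)
    then show ?case using c by simp
  next
    case (Suc n)
    have "sym_component (Suc n) (pbw u - u) = 0"
      using pbw_filtration[OF Suc.prems(1)] by (intro sym_component_filtration_less) auto
    then have "sym_component (Suc n) u = 0"
      using Suc.prems(2) sym_component_add[of "Suc n" "- u" u] by (simp add: sym_component_zero)
    then have "u \<in> sym_filtration n" using sym_component_top(2)[OF Suc.prems(1)] by simp
    then show ?case using Suc by blast
  qed
  then show "pbw u = 0 \<Longrightarrow> u = 0" using sym_filtration_exhaust by blast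
qed

lemma pbw_surjective: "\<exists>v. pbw v = u"
proof -
  have "u \<in> sym_filtration n \<Longrightarrow> \<exists>v. pbw v = u" for n u
  proof (induction n arbitrary: u)
    case 0
    have "u \<in> sym_power 0" by (metis 0 sym_component_in_power sym_component_top(1))
    then obtain c where "u = sym_scale c 1" by (auto simp: sym_power_def S.span_singleton)
    then show ?case by (metis pbw_one pbw_scale)
  next
    case (Suc n)
    then obtain v where "pbw v = pbw u - u" using pbw_filtration[OF Suc.prems] by fastforce
    then have "pbw (u - v) = u" using pbw_add[of "u - v" v] by simp
    then show ?case by blast
  qed
  then show ?thesis using sym_filtration_exhaust by blast
qed

lemma sym_power_sum: "\<exists>N. u = (\<Sum>n\<le>N. sym_component n u)"
proof -
  have "u \<in> sym_filtration n \<Longrightarrow> u = (\<Sum>i\<le>n. sym_component i u)" for n u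
  proof (induction n arbitrary: u)
    case 0
    then show ?case using sym_component_top(1)[of u 0] by simp
  next
    case (Suc n)
    let ?w = "u - sym_component (Suc n) u"
    have "?w = (\<Sum>i\<le>n. sym_component i ?w)"
      using sym_component_top(2)[OF Suc.prems] by (intro Suc.IH) simp
    also have "\<dots> = (\<Sum>i\<le>n. sym_component i u)"
    proof (rule sum.cong)
      fix i assume "i \<in> {..n}"
      then have "sym_component i (sym_component (Suc n) u) = 0"
        by (auto simp: sym_component_power[OF sym_component_in_power])
      then show "sym_component i ?w = sym_component i u"
        using sym_component_add[of i ?w "sym_component (Suc n) u"] by simp
    qed simp
    finally show ?case by (simp add: algebra_simps)
  qed
  then show ?thesis using sym_filtration_exhaust by blast
qed

lift_definition sym_proj :: "'k::field symalg \<Rightarrow> 'k prelie"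
  is "lin_ext prelie_scale (\<lambda>M. if size M = 1 then hd (list_of M) else 0)"
proof -
  fix p q :: "'k prelie multiset \<Rightarrow>\<^sub>0 'k"
  let ?F = "\<lambda>M :: 'k prelie multiset. if size M = 1 then hd (list_of M) else 0"
  have [simp]: "list_of {#x#} = [x]" for x :: "'k prelie"
    using mset_list_of[of "{#x#}"] by (simp del: mset_list_of)
  assume "sym_rel p q"
  then have "lin_ext prelie_scale ?F (p - q) = 0"
    by (intro lin_ext_sym_ideal[OF L.module_axioms]) (auto simp: sym_rel_def)
  then show "lin_ext prelie_scale ?F p = lin_ext prelie_scale ?F q" by (simp add: L.lin_ext_diff)
qed

lemma sym_proj_emb: "sym_proj (emb x) = x"
proof -
  have "list_of {#x#} = [x]" using mset_list_of[of "{#x#}"] by (simp del: mset_list_of)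
  then show ?thesis by (simp add: emb_def sym_proj.abs_eq)
qed

lemma emb_inject: "emb x = emb y \<longleftrightarrow> x = y"
  by (metis sym_proj_emb)

lemma sym_power_one: "u \<in> sym_power 1 \<Longrightarrow> \<exists>x. u = emb x"
  unfolding sym_power_def
proof (induction rule: S.span_induct_alt)
  case base
  show ?case using emb_0 by metis
next
  case (step c v w)
  then obtain x y where "v = emb x" "w = emb y" by (auto simp: length_Suc_conv)
  then show ?case by (metis emb_add emb_scale)
qed

lemma sol1_ex1:
  fixes u :: "'k::field_char_0 symalg"
  shows "\<exists>!x. u - emb x \<in> S.span (\<Union>j\<in>- {1}. pbw_component j)"
proof -
  let ?K = "S.span (\<Union>j\<in>- {1}. pbw_component j) :: 'k symalg set"
  have K: "\<exists>w. k = pbw w \<and> sym_component 1 w = 0" if "k \<in> ?K" for k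
    using that
  proof (induction rule: S.span_induct_alt)
    case base
    show ?case by (metis pbw_zero sym_component_zero)
  next
    case (step c v w)
    then obtain j v' where "j \<noteq> 1" "v = pbw v'" "v' \<in> sym_power j" by (auto simp: pbw_component_def)
    moreover obtain w' where "w = pbw w'" "sym_component 1 w' = 0" using step by auto
    ultimately have "sym_scale c v + w = pbw (sym_scale c v' + w')"
        "sym_component 1 (sym_scale c v' + w') = 0"
      by (auto simp: pbw_add pbw_scale sym_component_add sym_component_scale sym_component_power)
    then show ?case by blast
  qed
  obtain v where v: "pbw v = u" using pbw_surjective by blast
  have "\<exists>x. sym_component 1 v = emb x" by (rule sym_power_one[OF sym_component_in_power])
  then obtain x where x: "sym_component 1 v = emb x" by blast
  have pbw_diff: "pbw (a - b) = pbw a - pbw b" for a b :: "'k symalg"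
    using pbw_add[of "a - b" b] by simp
  show ?thesis
  proof (rule ex1I[of _ x])
    let ?w = "v - sym_component 1 v"
    have w1: "sym_component 1 ?w = 0"
      using sym_component_add[of 1 ?w "sym_component 1 v"]
      by (simp add: sym_component_power[OF sym_component_in_power])
    obtain N where N: "?w = (\<Sum>n\<le>N. sym_component n ?w)" using sym_power_sum by blast
    have pbw_sum: "pbw (\<Sum>n\<in>A. g n) = (\<Sum>n\<in>A. pbw (g n))" for A and g :: "nat \<Rightarrow> 'k symalg"
      by (induction A rule: infinite_finite_induct) (simp_all add: pbw_zero pbw_add)
    have "pbw (sym_component n ?w) \<in> ?K" for n
    proof (cases "n = 1")
      case True
      then show ?thesis using w1 by (simp add: pbw_zero S.span_zero)
    next
      case False
      then show ?thesis
        by (intro S.span_base UN_I[of n]) (simp_all add: pbw_component_def sym_component_in_power imageI)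
    qed
    then have "pbw ?w \<in> ?K" by (subst N) (simp add: pbw_sum S.span_sum)
    then show "u - emb x \<in> ?K" by (simp only: pbw_diff v x pbw_emb)
  next
    fix y assume "u - emb y \<in> ?K"
    then obtain w where w: "u - emb y = pbw w" "sym_component 1 w = 0" using K by blast
    have "pbw (v - (emb y + w)) = u - emb y - pbw w"
      by (simp only: pbw_diff pbw_add v pbw_emb diff_diff_eq)
    then have "pbw (v - (emb y + w)) = 0" using w(1) by simp
    then have "v = emb y + w" using pbw_injective by fastforce
    then have "emb x = sym_component 1 (emb y)" using w(2) x by (simp add: sym_component_add)
    also have "\<dots> = emb y" using sym_component_prod_list[of 1 "[y]"] by simp
    finally show "y = x" by (simp add: emb_inject)
  qed
qed

section \<open>Gradings\<close>

abbreviation mag_eval :: "mag \<Rightarrow> 'k::field prelie" where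
  "mag_eval \<equiv> mag_fold (\<lhd>) gen"

definition prelie_degree :: "nat \<Rightarrow> 'k::field prelie set" where
  "prelie_degree n = L.span {mag_eval t | t. leaves t = n}"

definition sym_degree :: "nat \<Rightarrow> 'k::field symalg set" where
  "sym_degree n = S.span {prod_list (map emb xs) | xs ds.
     list_all2 (\<lambda>x d. x \<in> prelie_degree d) xs ds \<and> sum_list ds = n}"

lemma gen_degree: "gen \<in> prelie_degree 1"
  unfolding prelie_degree_def by (rule L.span_base) (auto intro: exI[of _ Gen])

lemma prelie_degree_subspace: "L.subspace (prelie_degree n)"
  unfolding prelie_degree_def by (rule L.subspace_span)

lemma sym_degree_subspace: "S.subspace (sym_degree n)"
  unfolding sym_degree_def by (rule S.subspace_span)

lemmas prelie_degree_closed =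
  L.subspace_0[OF prelie_degree_subspace] L.subspace_add[OF prelie_degree_subspace]
  L.subspace_scale[OF prelie_degree_subspace]

lemmas sym_degree_closed =
  S.subspace_0[OF sym_degree_subspace] S.subspace_add[OF sym_degree_subspace]
  S.subspace_scale[OF sym_degree_subspace]

lemma prelie_degree_zero: "prelie_degree 0 = ({0} :: 'a::field prelie set)"
proof -
  have "{mag_eval t | t. leaves t = 0} = ({} :: 'a prelie set)"
    by (simp add: leaves_pos[THEN less_imp_neq, symmetric])
  then show ?thesis by (simp only: prelie_degree_def L.span_empty)
qed

lemma prelie_mult_degree:
  assumes x: "x \<in> prelie_degree m" and y: "y \<in> prelie_degree n"
  shows "x \<lhd> y \<in> prelie_degree (m + n)"
proof -
  have zero: "0 \<lhd> z = 0" "z \<lhd> 0 = 0" for z :: "'a prelie"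
    using prelie_mult_scale_left[of 0 0 z] prelie_mult_scale_right[of z 0 0] by simp_all
  have base: "mag_eval s \<lhd> mag_eval t \<in> prelie_degree (m + n)" if "leaves s = m" "leaves t = n" for s t
    unfolding prelie_degree_def using that by (intro L.span_base) (auto intro: exI[of _ "Node s t"])
  have *: "mag_eval s \<lhd> y \<in> prelie_degree (m + n)" if "leaves s = m" for s
    using y[unfolded prelie_degree_def]
  proof (induction rule: L.span_induct_alt)
    case (step c z w)
    then show ?case using base[OF that]
      by (auto simp: prelie_mult_add_right prelie_mult_scale_right intro!: prelie_degree_closed)
  qed (simp add: zero prelie_degree_closed)
  show ?thesis using x[unfolded prelie_degree_def]
  proof (induction rule: L.span_induct_alt)
    case (step c z w)
    then show ?case using *
      by (auto simp: prelie_mult_add_left prelie_mult_scale_left intro!: prelie_degree_closed)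
  qed (simp add: zero prelie_degree_closed)
qed

lemma prod_list_degree:
  "list_all2 (\<lambda>x d. x \<in> prelie_degree d) xs ds \<Longrightarrow> prod_list (map emb xs) \<in> sym_degree (sum_list ds)"
  unfolding sym_degree_def by (rule S.span_base) auto

lemma one_degree: "1 \<in> sym_degree 0"
  using prod_list_degree[of "[]" "[]"] by simp

lemma emb_degree: "x \<in> prelie_degree d \<Longrightarrow> emb x \<in> sym_degree d"
  using prod_list_degree[of "[x]" "[d]"] by simp

lemma sym_bilinear_degree:
  fixes f :: "'k::field symalg \<Rightarrow> 'k symalg \<Rightarrow> 'k symalg"
  assumes f: "\<And>u v w. f (u + v) w = f u w + f v w" "\<And>u v w. f u (v + w) = f u v + f u w"
      "\<And>c u v. f (sym_scale c u) v = sym_scale c (f u v)"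
      "\<And>c u v. f u (sym_scale c v) = sym_scale c (f u v)"
    and base: "\<And>xs ds ys es. list_all2 (\<lambda>x d. x \<in> prelie_degree d) xs ds \<Longrightarrow>
      list_all2 (\<lambda>x d. x \<in> prelie_degree d) ys es \<Longrightarrow>
      f (prod_list (map emb xs)) (prod_list (map emb ys)) \<in> sym_degree (sum_list ds + sum_list es)"
    and u: "u \<in> sym_degree m" and v: "v \<in> sym_degree n"
  shows "f u v \<in> sym_degree (m + n)"
proof -
  have zero: "f 0 z = 0" "f z 0 = 0" for z
    using f(3)[of 0 0 z] f(4)[of z 0 0] by simp_all
  have *: "f (prod_list (map emb xs)) v \<in> sym_degree (m + n)"
    if "list_all2 (\<lambda>x d. x \<in> prelie_degree d) xs ds" "sum_list ds = m" for xs ds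
    using v[unfolded sym_degree_def]
  proof (induction rule: S.span_induct_alt)
    case (step c z w)
    then show ?case using base[OF that(1)] that(2) by (auto simp: f intro!: sym_degree_closed)
  qed (simp add: zero sym_degree_closed)
  show ?thesis using u[unfolded sym_degree_def]
  proof (induction rule: S.span_induct_alt)
    case (step c z w)
    then show ?case using * by (auto simp: f intro!: sym_degree_closed)
  qed (simp add: zero sym_degree_closed)
qed

lemma sym_mult_degree:
  "u \<in> sym_degree m \<Longrightarrow> v \<in> sym_degree n \<Longrightarrow> u * v \<in> sym_degree (m + n)"
proof (rule sym_bilinear_degree[where f = "(*)"])
  fix xs ys :: "'a prelie list" and ds es
  assume "list_all2 (\<lambda>x d. x \<in> prelie_degree d) xs ds" "list_all2 (\<lambda>x d. x \<in> prelie_degree d) ys es"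
  then show "prod_list (map emb xs) * prod_list (map emb ys) \<in> sym_degree (sum_list ds + sum_list es)"
    using prod_list_degree[of "xs @ ys" "ds @ es"] by (simp add: list_all2_appendI)
qed (simp_all add: distrib_left distrib_right sym_scale_mult_left sym_scale_mult_right)

lemma sym_prod_degree:
  "finite A \<Longrightarrow> (\<And>i. i \<in> A \<Longrightarrow> u i \<in> sym_degree (d i)) \<Longrightarrow> prod u A \<in> sym_degree (sum d A)"
  by (induction A rule: finite_induct) (auto simp: one_degree intro: sym_mult_degree)

lemma act_list_degree:
  "c \<in> prelie_degree e \<Longrightarrow> list_all2 (\<lambda>x d. x \<in> prelie_degree d) bs ds \<Longrightarrow>
    act_list c bs \<in> prelie_degree (e + sum_list ds)"
proof (induction c bs arbitrary: ds rule: act_list.induct)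
  case (2 c b bs)
  then obtain d ds' where ds: "ds = d # ds'" "b \<in> prelie_degree d"
      and all: "list_all2 (\<lambda>x d. x \<in> prelie_degree d) bs ds'"
    by (auto simp: list_all2_Cons1)
  have "act_list c bs \<lhd> b \<in> prelie_degree (e + sum_list ds' + d)"
    using 2 all ds by (intro prelie_mult_degree) auto
  moreover have "act_list c (bs[i := bs ! i \<lhd> b]) \<in> prelie_degree (e + sum_list ds)"
    if i: "i < length bs" for i
  proof -
    have "list_all2 (\<lambda>x d. x \<in> prelie_degree d) (bs[i := bs ! i \<lhd> b]) (ds'[i := ds' ! i + d])"
      using all ds i by (intro list_all2_update_cong prelie_mult_degree) (auto simp: list_all2_conv_all_nth)
    moreover have "i < length ds'" using i all by (auto dest: list_all2_lengthD)
    then have "sum_list (ds'[i := ds' ! i + d]) = sum_list ds"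
      using ds elem_le_sum_list[of i ds'] by (simp add: sum_list_update)
    ultimately show ?thesis using 2(2)[of i] 2(3) i by fastforce
  qed
  ultimately show ?case
    using ds by (auto simp: add_ac intro!: L.subspace_diff L.subspace_sum prelie_degree_subspace)
qed simp

lemma act_degree:
  assumes c: "c \<in> prelie_degree m" and u: "u \<in> sym_degree n"
  shows "c \<lhd>\<^sub>S u \<in> prelie_degree (m + n)"
  using u[unfolded sym_degree_def]
proof (induction rule: S.span_induct_alt)
  case base
  show ?case using act_scale_right[of c 0 0] prelie_degree_closed by simp
  case (step r z w)
  then show ?case using act_list_degree[OF c]
    by (auto simp: act_add_right act_scale_right act_prod_list intro!: prelie_degree_closed)
qed

lemma fibre_prod_degree:
  "list_all2 (\<lambda>x d. x \<in> prelie_degree d) bs es \<Longrightarrow>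
    fibre_prod bs f i \<in> sym_degree (\<Sum>j | j < length bs \<and> f j = i. es ! j)"
  unfolding fibre_prod_def
  by (intro sym_prod_degree emb_degree) (auto simp: list_all2_conv_all_nth)

lemma star_list_degree:
  assumes as: "list_all2 (\<lambda>x d. x \<in> prelie_degree d) as ds"
    and bs: "list_all2 (\<lambda>x d. x \<in> prelie_degree d) bs es"
  shows "star_list as bs \<in> sym_degree (sum_list ds + sum_list es)"
  unfolding star_list_def
proof (intro S.subspace_sum sym_degree_subspace)
  fix f assume f: "f \<in> {..<length bs} \<rightarrow>\<^sub>E {..length as}"
  let ?e = "\<lambda>i. \<Sum>j | j < length bs \<and> f j = i. es ! j"
  have "star_term as bs f \<in> sym_degree (?e 0 + (\<Sum>i<length as. ds ! i + ?e (Suc i)))"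
    unfolding star_term_def using as
    by (intro sym_mult_degree sym_prod_degree emb_degree act_degree fibre_prod_degree[OF bs])
      (auto simp: list_all2_conv_all_nth)
  also have "?e 0 + (\<Sum>i<length as. ds ! i + ?e (Suc i)) = (\<Sum>i<length as. ds ! i) + (\<Sum>i\<le>length as. ?e i)"
    by (simp add: sum.distrib sum.atMost_shift)
  also have "(\<Sum>i\<le>length as. ?e i) = (\<Sum>j<length bs. es ! j)"
    using sum.group[of "{..<length bs}" "{..length as}" f "\<lambda>j. es ! j"] f by fastforce
  also have "(\<Sum>j<length bs. es ! j) = sum_list es"
    using list_all2_lengthD[OF bs] by (simp add: sum_list_sum_nth atLeast0LessThan)
  also have "(\<Sum>i<length as. ds ! i) = sum_list ds"
    using list_all2_lengthD[OF as] by (simp add: sum_list_sum_nth atLeast0LessThan)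
  finally show "star_term as bs f \<in> sym_degree (sum_list ds + sum_list es)" .
qed

lemma star_degree:
  "u \<in> sym_degree m \<Longrightarrow> v \<in> sym_degree n \<Longrightarrow> u \<star> v \<in> sym_degree (m + n)"
  by (rule sym_bilinear_degree[where f = star])
    (simp_all add: star_add_left star_add_right star_scale_left star_scale_right star_prod_list
      star_list_degree)

section \<open>Completions\<close>

text \<open>
  An element of a completion is the family of its homogeneous components. Bilinear operations
  that are compatible with the gradings extend by \<open>cauchy\<close>, graded linear maps componentwise.
\<close>

definition completion :: "(nat \<Rightarrow> 'v set) \<Rightarrow> (nat \<Rightarrow> 'v) set" where
  "completion V = {x. \<forall>n. x n \<in> V n}"

definition cauchy ::
    "('u \<Rightarrow> 'v \<Rightarrow> 'w::comm_monoid_add) \<Rightarrow> (nat \<Rightarrow> 'u) \<Rightarrow> (nat \<Rightarrow> 'v) \<Rightarrow> nat \<Rightarrow> 'w" where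
  "cauchy f x y n = (\<Sum>i\<le>n. f (x i) (y (n - i)))"

definition hat_one :: "nat \<Rightarrow> 'k::field symalg" where
  "hat_one n = (if n = 0 then 1 else 0)"

primrec hat_pow ::
    "('k::field symalg \<Rightarrow> 'k symalg \<Rightarrow> 'k symalg) \<Rightarrow> (nat \<Rightarrow> 'k symalg) \<Rightarrow> nat \<Rightarrow> nat \<Rightarrow> 'k symalg" where
  "hat_pow f u 0 = hat_one"
| "hat_pow f u (Suc k) = cauchy f (hat_pow f u k) u"

text \<open>
  The series \<open>\<Sum>k. c\<^sub>k u\<^sup>k\<close>, with powers for the product \<open>f\<close>. If \<open>u\<close> has no component of
  degree 0, the sum is finite in every degree (\<open>hat_pow_eq_0\<close>).
\<close>

definition hat_series ::
    "('k::field symalg \<Rightarrow> 'k symalg \<Rightarrow> 'k symalg) \<Rightarrow> (nat \<Rightarrow> 'k) \<Rightarrow> (nat \<Rightarrow> 'k symalg) \<Rightarrow> nat \<Rightarrow> 'k symalg" where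
  "hat_series f c u n = Sum_any (\<lambda>k. sym_scale (c k) (hat_pow f u k n))"

lemma hat_pow_eq_0:
  assumes "f 0 0 = 0" "\<And>v. f v 0 = 0" "\<And>v. f 0 v = 0" "u 0 = 0" "n < k"
  shows "hat_pow f u k n = 0"
  using \<open>n < k\<close>
proof (induction k arbitrary: n)
  case (Suc k)
  have "f (hat_pow f u k i) (u (n - i)) = 0" if "i \<le> n" for i
  proof (cases "i = n")
    case False
    then show ?thesis using Suc that assms by simp
  qed (simp add: assms)
  then show ?case by (simp add: cauchy_def)
qed simp

definition bernoulli :: "nat \<Rightarrow> 'k::field_char_0" where
  "bernoulli n = fact n * fps_nth (fps_X / (fps_exp 1 - 1)) n"

lemma bernoulli_series:
  "Abs_fps (\<lambda>n. bernoulli n / fact n) * (fps_exp 1 - 1) = (fps_X :: 'k::field_char_0 fps)"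
proof -
  have "fps_nth (fps_exp 1 - 1 :: 'k fps) 1 \<noteq> 0" by simp
  have "Abs_fps (\<lambda>n. bernoulli n / fact n) = (fps_X / (fps_exp 1 - 1) :: 'k fps)"
    by (simp add: fps_eq_iff bernoulli_def)
  moreover have "(fps_exp 1 - 1 :: 'k fps) dvd fps_X"
  proof -
    have "subdegree (fps_exp 1 - 1 :: 'k fps) = 1"
      by (rule subdegreeI) auto
    moreover have "(fps_exp 1 - 1 :: 'k fps) \<noteq> 0" using \<open>_ \<noteq> 0\<close> by fastforce
    ultimately show ?thesis by (simp add: fps_dvd_iff)
  qed
  ultimately show ?thesis by simp
qed

definition hat_gen :: "nat \<Rightarrow> 'k::field prelie" where
  "hat_gen n = (if n = 1 then gen else 0)"

definition hat_emb :: "(nat \<Rightarrow> 'k::field prelie) \<Rightarrow> nat \<Rightarrow> 'k symalg" where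
  "hat_emb x n = emb (x n)"

text \<open>\<open>todd_star u\<close> is \<open>u / (exp u - 1)\<close>, computed with the product \<open>\<star>\<close>.\<close>

definition todd_star :: "(nat \<Rightarrow> 'k::field_char_0 symalg) \<Rightarrow> nat \<Rightarrow> 'k symalg" where
  "todd_star = hat_series (\<star>) (\<lambda>k. bernoulli k / fact k)"

definition hat_exp :: "(nat \<Rightarrow> 'k::field_char_0 symalg) \<Rightarrow> nat \<Rightarrow> 'k symalg" where
  "hat_exp = hat_series (*) (\<lambda>k. 1 / fact k)"

definition log_star :: "(nat \<Rightarrow> 'k::field_char_0 symalg) \<Rightarrow> nat \<Rightarrow> 'k symalg" where
  "log_star u = hat_series (\<star>) (\<lambda>k. if k = 0 then 0 else (- 1) ^ (k - 1) / of_nat k) (\<lambda>n. u n - hat_one n)"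

lemma hat_exp_gen: "hat_exp (hat_emb hat_gen) n = sym_scale (1 / fact n) (emb gen ^ n)"
proof -
  have *: "hat_pow (*) (hat_emb hat_gen) k m = (if m = k then emb gen ^ k else 0)" for k m
  proof (induction k arbitrary: m)
    case (Suc k)
    have "(\<Sum>i\<le>m. (if i = k then emb gen ^ k else 0) * hat_emb hat_gen (m - i)) =
        (\<Sum>i\<in>{..m} \<inter> {k}. emb gen ^ k * hat_emb hat_gen (m - i))"
      by (intro sum.mono_neutral_cong_right) auto
    also have "\<dots> = (if m = Suc k then emb gen ^ Suc k else 0)"
      by (cases "k \<le> m") (auto simp: hat_emb_def hat_gen_def emb_0 mult.commute)
    finally show ?case by (simp add: cauchy_def Suc)
  qed (simp add: hat_one_def)
  have "hat_exp (hat_emb hat_gen) n =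
      (\<Sum>k\<in>{n}. sym_scale (1 / fact k) (hat_pow (*) (hat_emb hat_gen) k n))"
    unfolding hat_exp_def hat_series_def by (intro Sum_any.expand_superset) (auto simp: *)
  then show ?thesis by (simp add: *)
qed

section \<open>Existence and uniqueness of the Magnus element\<close>

lemma causal_fixpoint:
  fixes F :: "(nat \<Rightarrow> 'v) \<Rightarrow> nat \<Rightarrow> 'v"
  assumes F: "\<And>x y n. (\<And>m. m < n \<Longrightarrow> x m = y m) \<Longrightarrow> F x n = F y n"
    and V: "\<And>x. x \<in> completion V \<Longrightarrow> F x \<in> completion V" "z \<in> completion V"
  shows "\<exists>!x. x \<in> completion V \<and> F x = x"
proof -
  let ?G = "\<lambda>k. (F ^^ k) z"
  have G: "?G k \<in> completion V" for k
    by (induction k) (auto simp: V)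
  have step: "?G k m = ?G (Suc k) m" if "m < k" for k m
    using that by (induction k arbitrary: m) (auto intro: F)
  have stable: "?G k m = ?G (Suc m) m" if "m < k" for k m
    using that
  proof (induction k)
    case (Suc k)
    then show ?case using step[of m k] by (cases "m = k") auto
  qed simp
  define x where "x m = ?G (Suc m) m" for m
  have "F x n = x n" for n
  proof -
    have "F x n = F (?G n) n" by (rule F) (simp add: x_def stable)
    then show ?thesis by (simp add: x_def)
  qed
  moreover have "x \<in> completion V" using G unfolding x_def completion_def by blast
  moreover have "x = y" if "F x = x" "F y = y" for x y
  proof
    fix n show "x n = y n"
    proof (induction n rule: less_induct)
      case (less n)
      then show ?case using F[of n x y] that by metis
    qed
  qed
  ultimately show ?thesis by blast
qed

lemma cauchy_cong:
  "(\<And>m. m \<le> n \<Longrightarrow> x m = x' m) \<Longrightarrow> (\<And>m. m \<le> n \<Longrightarrow> y m = y' m) \<Longrightarrow> cauchy f x y n = cauchy f x' y' n"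
  by (simp add: cauchy_def)

lemma hat_pow_cong:
  "(\<And>m. m \<le> n \<Longrightarrow> u m = v m) \<Longrightarrow> hat_pow f u k n = hat_pow f v k n"
  by (induction k arbitrary: n) (auto intro: cauchy_cong)

lemma cauchy_completion:
  assumes "\<And>u v m n. u \<in> A m \<Longrightarrow> v \<in> B n \<Longrightarrow> f u v \<in> C (m + n)" "\<And>n. 0 \<in> C n"
    "\<And>n u v. u \<in> C n \<Longrightarrow> v \<in> C n \<Longrightarrow> u + v \<in> C n" "x \<in> completion A" "y \<in> completion B"
  shows "cauchy f x y \<in> completion C"
proof -
  have "(\<Sum>i\<in>I. f (x i) (y (n - i))) \<in> C n" if "I \<subseteq> {..n}" "finite I" for n I
    using that(2,1)
  proof (induction I rule: finite_induct)
    case (insert i I)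
    then have "f (x i) (y (n - i)) \<in> C (i + (n - i))"
      using assms(1)[of "x i" i "y (n - i)" "n - i"] assms(4,5) by (simp add: completion_def)
    moreover have "i + (n - i) = n" using insert by simp
    ultimately show ?case using insert assms(3) by simp
  qed (simp add: assms(2))
  then show ?thesis by (simp add: completion_def cauchy_def)
qed

lemma hat_series_completion:
  assumes f: "\<And>u v m n. u \<in> sym_degree m \<Longrightarrow> v \<in> sym_degree n \<Longrightarrow> f u v \<in> sym_degree (m + n)"
    and u: "u \<in> completion sym_degree"
  shows "hat_series f c u \<in> completion sym_degree"
proof -
  have pow: "hat_pow f u k \<in> completion sym_degree" for k
  proof (induction k)
    case 0
    then show ?case
      by (simp add: completion_def hat_one_def one_degree sym_degree_closed)
  next
    case (Suc k)
    then have "cauchy f (hat_pow f u k) u \<in> completion sym_degree"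
      using u by (intro cauchy_completion[where A = sym_degree and B = sym_degree])
        (simp_all add: f sym_degree_closed)
    then show ?case by simp
  qed
  then show ?thesis
    by (auto simp: completion_def hat_series_def Sum_any.expand_set
        intro!: S.subspace_sum S.subspace_scale sym_degree_subspace)
qed

lemma magnus_ex1:
  "\<exists>!\<Omega>. \<Omega> \<in> completion prelie_degree \<and> cauchy (\<lhd>\<^sub>S) hat_gen (todd_star (hat_emb \<Omega>)) = \<Omega>"
proof (rule causal_fixpoint)
  let ?F = "\<lambda>\<Omega> :: nat \<Rightarrow> 'a prelie. cauchy (\<lhd>\<^sub>S) hat_gen (todd_star (hat_emb \<Omega>))"
  have zero: "0 \<lhd>\<^sub>S u = 0" for u :: "'a symalg" using act_scale_left[of 0 0 u] by simp
  fix x y :: "nat \<Rightarrow> 'a prelie" and n assume eq: "\<And>m. m < n \<Longrightarrow> x m = y m"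
  have todd: "todd_star (hat_emb x) m = todd_star (hat_emb y) m" if "m < n" for m
  proof -
    have "hat_pow (\<star>) (hat_emb x) k m = hat_pow (\<star>) (hat_emb y) k m" for k
      using that eq by (intro hat_pow_cong) (simp add: hat_emb_def)
    then show ?thesis by (simp add: todd_star_def hat_series_def)
  qed
  show "?F x n = ?F y n"
    unfolding cauchy_def
    by (intro sum.cong refl) (auto simp: hat_gen_def zero intro!: arg_cong[of _ _ "(\<lhd>\<^sub>S) gen"] todd)
next
  fix x :: "nat \<Rightarrow> 'a prelie" assume "x \<in> completion prelie_degree"
  then have "hat_emb x \<in> completion sym_degree" by (simp add: completion_def hat_emb_def emb_degree)
  then have "todd_star (hat_emb x) \<in> completion sym_degree"
    unfolding todd_star_def by (intro hat_series_completion star_degree)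
  moreover have "hat_gen \<in> completion (prelie_degree :: nat \<Rightarrow> 'a prelie set)"
    using gen_degree by (simp add: completion_def hat_gen_def prelie_degree_closed)
  ultimately show "cauchy (\<lhd>\<^sub>S) hat_gen (todd_star (hat_emb x)) \<in> completion prelie_degree"
    by (intro cauchy_completion[where A = prelie_degree and B = sym_degree])
      (simp_all add: act_degree prelie_degree_closed)
next
  show "(\<lambda>_. 0) \<in> completion prelie_degree"
    by (simp add: completion_def prelie_degree_closed)
qed

end

theory Submission
  imports Defs
begin

text \<open>
  For \<open>b\<close> in \<open>L\<close>, right multiplication is \<open>u \<star> b = u * b + der b u\<close> with \<open>der b\<close> the derivation of
  \<open>S(L)\<close> that extends \<open>x \<mapsto> x \<lhd> b\<close>. Write \<open>R\<close> for \<open>x \<mapsto> x \<lhd> \<Omega>\<close>. Both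
  \<open>\<Sum>n. t\<^sup>n/n! \<Omega>\<^sup>n\<close> (powers for \<open>\<star>\<close>) and the commutative exponential of
  \<open>\<Sum>n\<ge>1. t\<^sup>n/n! R\<^sup>n\<^sup>-\<^sup>1 \<Omega>\<close> solve \<open>Y' = Y \<star> \<Omega>\<close>, \<open>Y(0) = 1\<close>. The equation for \<open>\<Omega>\<close> reads
  \<open>R/(exp R - 1) a = \<Omega>\<close>; it says that \<open>\<Sum>n\<ge>1. 1/n! R\<^sup>n\<^sup>-\<^sup>1 \<Omega> = a\<close>. At \<open>t = 1\<close> the exponential
  of \<open>\<Omega>\<close> for \<open>\<star>\<close> is therefore \<open>exp a\<close>. Its logarithm is \<open>\<Omega>\<close>, and so is its projection,
  because \<open>\<Omega>\<^sup>n\<close> lies in \<open>P\<^sub>n\<close>.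
\<close>

section \<open>Linearity of the operations\<close>

lemma star_zero_left [simp]: "0 \<star> u = 0"
  using star_scale_left[of 0 0 u] by simp

lemma star_zero_right [simp]: "u \<star> 0 = 0"
  using star_scale_right[of u 0 0] by simp

lemma star_sum_left: "(\<Sum>i\<in>A. f i) \<star> u = (\<Sum>i\<in>A. f i \<star> u)"
  by (induction A rule: infinite_finite_induct) (simp_all add: star_add_left)

lemma star_sum_right: "u \<star> (\<Sum>i\<in>A. f i) = (\<Sum>i\<in>A. u \<star> f i)"
  by (induction A rule: infinite_finite_induct) (simp_all add: star_add_right)

lemma act_zero_right [simp]: "c \<lhd>\<^sub>S 0 = 0"
  using act_scale_right[of c 0 0] by simp

lemma act_sum_right: "c \<lhd>\<^sub>S (\<Sum>i\<in>A. f i) = (\<Sum>i\<in>A. c \<lhd>\<^sub>S f i)"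
  by (induction A rule: infinite_finite_induct) (simp_all add: act_add_right)

lemma prelie_mult_zero_left [simp]: "0 \<lhd> x = 0"
  using prelie_mult_scale_left[of 0 0 x] by simp

lemma prelie_mult_zero_right [simp]: "x \<lhd> 0 = 0"
  using prelie_mult_scale_right[of x 0 0] by simp

lemma sum_emb: "emb (\<Sum>i\<in>A. f i) = (\<Sum>i\<in>A. emb (f i))"
  by (induction A rule: infinite_finite_induct) (simp_all add: emb_add emb_0)

section \<open>Right multiplication by an element of \<open>L\<close>\<close>

text \<open>Being a difference of two bilinear products, it is linear at once; that it is a
  derivation is the content of \<open>der_mult\<close>.\<close>

definition der :: "'k::field prelie \<Rightarrow> 'k symalg \<Rightarrow> 'k symalg" where
  "der b u = u \<star> emb b - u * emb b"

lemma star_emb: "u \<star> emb b = u * emb b + der b u"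
  by (simp add: der_def)

lemma der_add: "der b (u + v) = der b u + der b v"
  by (simp add: der_def star_add_left distrib_right)

lemma der_scale: "der b (sym_scale c u) = sym_scale c (der b u)"
  by (simp add: der_def star_scale_left sym_scale_mult_left S.scale_right_diff_distrib)

lemma der_zero [simp]: "der b 0 = 0"
  by (simp add: der_def)

lemma der_sum: "der b (\<Sum>i\<in>A. f i) = (\<Sum>i\<in>A. der b (f i))"
  by (induction A rule: infinite_finite_induct) (simp_all add: der_add)

lemma fibre_prod_snoc:
  "fibre_prod (bs @ [b]) (f(length bs := y)) i = (if y = i then emb b else 1) * fibre_prod bs f i"
proof -
  have "{j. j < length (bs @ [b]) \<and> (f(length bs := y)) j = i} =
      (if y = i then {length bs} else {}) \<union> {j. j < length bs \<and> f j = i}"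
    by (auto simp: less_Suc_eq)
  then show ?thesis
    unfolding fibre_prod_def
    by (auto simp: nth_append intro!: prod.cong)
qed

text \<open>A map on the enlarged index set is a map \<open>f\<close> on the old one plus a value
  for the new factor \<open>b\<close>. Value 0 puts \<open>b\<close> into the free factor, value
  \<open>Suc k\<close> into the product that acts on \<open>as ! k\<close>.\<close>

lemma star_list_snoc:
  "star_list as (bs @ [b]) =
    (\<Sum>f\<in>{..<length bs} \<rightarrow>\<^sub>E {..length as}. emb b * star_term as bs f +
      (\<Sum>k<length as. fibre_prod bs f 0 * (emb (as ! k \<lhd>\<^sub>S (fibre_prod bs f (Suc k) * emb b)) *
        (\<Prod>i\<in>{..<length as} - {k}. emb (as ! i \<lhd>\<^sub>S fibre_prod bs f (Suc i))))))"
proof -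
  let ?m = "length bs" and ?l = "length as"
  let ?F = "{..<?m} \<rightarrow>\<^sub>E {..?l}"
  let ?h = "\<lambda>f y. star_term as (bs @ [b]) (f(?m := y))"
  have ins: "{..<length (bs @ [b])} = insert ?m {..<?m}" by auto
  have "star_list as (bs @ [b]) = (\<Sum>(y, f)\<in>{..?l} \<times> ?F. ?h f y)"
    unfolding star_list_def ins PiE_insert_eq
    by (subst sum.reindex[OF inj_combinator]) (auto simp: case_prod_unfold)
  also have "\<dots> = (\<Sum>f\<in>?F. \<Sum>y\<le>?l. ?h f y)"
    by (subst sum.swap) (simp add: sum.cartesian_product)
  also have "\<dots> = (\<Sum>f\<in>?F. emb b * star_term as bs f +
      (\<Sum>k<?l. fibre_prod bs f 0 * (emb (as ! k \<lhd>\<^sub>S (fibre_prod bs f (Suc k) * emb b)) *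
        (\<Prod>i\<in>{..<?l} - {k}. emb (as ! i \<lhd>\<^sub>S fibre_prod bs f (Suc i))))))"
  proof (intro sum.cong refl)
    fix f assume "f \<in> ?F"
    have "?h f 0 = emb b * star_term as bs f"
      by (simp add: star_term_def fibre_prod_snoc mult.assoc)
    moreover have "?h f (Suc k) = fibre_prod bs f 0 *
        (emb (as ! k \<lhd>\<^sub>S (fibre_prod bs f (Suc k) * emb b)) *
          (\<Prod>i\<in>{..<?l} - {k}. emb (as ! i \<lhd>\<^sub>S fibre_prod bs f (Suc i))))" if "k < ?l" for k
      using that unfolding star_term_def
      by (subst prod.remove[of _ k]) (auto simp: fibre_prod_snoc mult.commute intro!: prod.cong)
    ultimately show "(\<Sum>y\<le>?l. ?h f y) = emb b * star_term as bs f +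
      (\<Sum>k<?l. fibre_prod bs f 0 * (emb (as ! k \<lhd>\<^sub>S (fibre_prod bs f (Suc k) * emb b)) *
        (\<Prod>i\<in>{..<?l} - {k}. emb (as ! i \<lhd>\<^sub>S fibre_prod bs f (Suc i)))))"
      by (simp add: sum.atMost_shift)
  qed
  finally show ?thesis .
qed

lemma prod_list_emb: "prod_list (map emb xs) = (\<Prod>i<length xs. emb (xs ! i))"
  by (simp add: prod.list_conv_set_nth atLeast0LessThan)

text \<open>Take \<open>bs = []\<close> in \<open>star_list_snoc\<close>: value 0 for
  \<open>b\<close> gives the commutative product, and every other value lets \<open>b\<close> act on
  one factor.\<close>

lemma der_prod_list:
  "der b (prod_list (map emb as)) = (\<Sum>i<length as. prod_list (map emb (as[i := as ! i \<lhd> b])))"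
proof -
  have upd: "prod_list (map emb (as[k := x])) = emb x * (\<Prod>i\<in>{..<length as} - {k}. emb (as ! i))"
    if "k < length as" for k x
    using that by (auto simp: prod_list_emb prod.remove[of _ k] intro!: prod.cong)
  have [simp]: "fibre_prod [] f i = 1" for f i by (simp add: fibre_prod_def)
  have "prod_list (map emb as) \<star> emb b = star_list as ([] @ [b])"
    using star_prod_list[of as "[b]"] by simp
  also have "\<dots> = prod_list (map emb as) * emb b + (\<Sum>i<length as. prod_list (map emb (as[i := as ! i \<lhd> b])))"
    unfolding star_list_snoc
    by (simp add: star_term_def act_one act_emb upd prod_list_emb[of as] mult.commute)
  finally show ?thesis by (simp add: der_def)
qed

lemma der_one [simp]: "der b 1 = 0"
  using der_prod_list[of b "[]"] by simp

lemma der_emb: "der b (emb x) = emb (x \<lhd> b)"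
  using der_prod_list[of b "[x]"] by simp

lemma mon_list_of: "mon M = prod_list (map emb (list_of M))"
  by (metis mon_mset mset_list_of)

text \<open>The formula of \<open>der_prod_list\<close> is a sum over the factors, so splitting one
  generator off a monomial gives the rule; induction on the monomial and linearity do the
  rest.\<close>

lemma der_mult: "der b (u * v) = der b u * v + u * der b v"
proof -
  have emb: "der b (emb x * v) = der b (emb x) * v + emb x * der b v" for x v
  proof (induction v rule: sym_induct)
    case (add c M v)
    have "der b (emb x * mon M) = der b (emb x) * mon M + emb x * der b (mon M)"
      unfolding mon_list_of using der_prod_list[of b "x # list_of M"]
      by (simp add: der_prod_list sum.lessThan_Suc_shift der_emb sum_distrib_left del: sum.lessThan_Suc)
    with add show ?case
      by (simp add: der_add der_scale distrib_left sym_scale_mult_right S.scale_right_distrib)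
  qed simp
  have mon: "der b (mon M * v) = der b (mon M) * v + mon M * der b v" for M
    by (induction M) (simp_all add: mon_add_mset emb mult.assoc distrib_left distrib_right)
  show ?thesis
    by (induction u rule: sym_induct)
      (simp_all add: der_add der_scale distrib_right sym_scale_mult_left mon S.scale_right_distrib)
qed

lemma der_prod:
  "finite A \<Longrightarrow> der b (prod f A) = (\<Sum>i\<in>A. der b (f i) * prod f (A - {i}))"
proof (induction A rule: finite_induct)
  case (insert x A)
  have "prod f (insert x A - {i}) = f x * prod f (A - {i})" if "i \<in> A" for i
  proof -
    have "insert x A - {i} = insert x (A - {i})" using insert that by auto
    then show ?thesis using insert by simp
  qed
  then have "(\<Sum>i\<in>A. der b (f i) * prod f (insert x A - {i})) = f x * (\<Sum>i\<in>A. der b (f i) * prod f (A - {i}))"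
    by (simp add: sum_distrib_left mult.left_commute)
  moreover have "insert x A - {x} = A" using insert by auto
  ultimately show ?case using insert by (simp add: der_mult)
qed simp

text \<open>On monomials this is the recursion that defines the action: the sum subtracted there is
  the action of \<open>der b v\<close>.\<close>

lemma act_star_emb: "c \<lhd>\<^sub>S (v \<star> emb b) = (c \<lhd>\<^sub>S v) \<lhd> b"
proof (induction v rule: sym_induct)
  case (add r M v)
  have "c \<lhd>\<^sub>S (mon M \<star> emb b) = (c \<lhd>\<^sub>S mon M) \<lhd> b"
    unfolding mon_list_of star_emb
    by (simp add: act_add_right act_prod_snoc der_prod_list act_sum_right)
  with add show ?case
    by (simp add: star_add_left star_scale_left act_add_right act_scale_right
        prelie_mult_add_left prelie_mult_scale_left)
qed simp

lemma der_fibre_prod: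
  "der b (fibre_prod bs f i) =
    (\<Sum>j | j < length bs \<and> f j = i. fibre_prod (bs[j := bs ! j \<lhd> b]) f i)"
proof -
  let ?A = "{j. j < length bs \<and> f j = i}"
  have "fibre_prod (bs[j := x]) f i = emb x * (\<Prod>k\<in>?A - {j}. emb (bs ! k))" if "j \<in> ?A" for j x
    using that by (auto simp: fibre_prod_def prod.remove[of _ j] intro!: prod.cong)
  then show ?thesis
    by (simp add: fibre_prod_def[of bs] der_prod der_emb)
qed

text \<open>Grouping the indices \<open>j\<close> by \<open>f j\<close> isolates the one fibre
  product that an update changes; summed over that fibre, the updates amount to \<open>der b\<close>
  of its product.\<close>

lemma sum_star_term_update:
  assumes f: "f \<in> {..<length bs} \<rightarrow>\<^sub>E {..length as}"
  shows "(\<Sum>j<length bs. star_term as (bs[j := bs ! j \<lhd> b]) f) =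
    der b (fibre_prod bs f 0) * (\<Prod>i<length as. emb (as ! i \<lhd>\<^sub>S fibre_prod bs f (Suc i))) +
    (\<Sum>k<length as. fibre_prod bs f 0 * (emb (as ! k \<lhd>\<^sub>S der b (fibre_prod bs f (Suc k))) *
      (\<Prod>i\<in>{..<length as} - {k}. emb (as ! i \<lhd>\<^sub>S fibre_prod bs f (Suc i)))))"
proof -
  let ?m = "length bs" and ?l = "length as"
  let ?bs = "\<lambda>j. bs[j := bs ! j \<lhd> b]"
  let ?J = "\<lambda>i. {j. j < length bs \<and> f j = i}"
  have other: "fibre_prod (?bs j) f i = fibre_prod bs f i" if "f j \<noteq> i" for i j
    using that unfolding fibre_prod_def by (intro prod.cong) (auto, metis nth_list_update_neq)
  have "(\<Sum>j<?m. star_term as (?bs j) f) = (\<Sum>i\<le>?l. \<Sum>j\<in>?J i. star_term as (?bs j) f)"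
    using sum.group[of "{..<?m}" "{..?l}" f "\<lambda>j. star_term as (?bs j) f"] f by fastforce
  moreover have "(\<Sum>j\<in>?J 0. star_term as (?bs j) f) =
      der b (fibre_prod bs f 0) * (\<Prod>i<?l. emb (as ! i \<lhd>\<^sub>S fibre_prod bs f (Suc i)))"
    by (simp add: star_term_def other der_fibre_prod sum_distrib_right)
  moreover have "(\<Sum>j\<in>?J (Suc k). star_term as (?bs j) f) =
      fibre_prod bs f 0 * (emb (as ! k \<lhd>\<^sub>S der b (fibre_prod bs f (Suc k))) *
      (\<Prod>i\<in>{..<?l} - {k}. emb (as ! i \<lhd>\<^sub>S fibre_prod bs f (Suc i))))" (is "_ = ?r")
    if k: "k < ?l" for k
  proof -
    have "star_term as (?bs j) f =
        fibre_prod bs f 0 * (emb (as ! k \<lhd>\<^sub>S fibre_prod (?bs j) f (Suc k)) *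
        (\<Prod>i\<in>{..<?l} - {k}. emb (as ! i \<lhd>\<^sub>S fibre_prod bs f (Suc i))))" if "j \<in> ?J (Suc k)" for j
      unfolding star_term_def using that k
      by (subst prod.remove[of _ k]) (auto simp: other intro!: prod.cong)
    then show ?thesis
      by (simp add: der_fibre_prod act_sum_right sum_emb sum_distrib_left sum_distrib_right)
  qed
  ultimately show ?thesis by (simp add: sum.atMost_shift)
qed

lemma der_star_term:
  "der b (star_term as bs f) =
    der b (fibre_prod bs f 0) * (\<Prod>i<length as. emb (as ! i \<lhd>\<^sub>S fibre_prod bs f (Suc i))) +
    (\<Sum>k<length as. fibre_prod bs f 0 * (emb ((as ! k \<lhd>\<^sub>S fibre_prod bs f (Suc k)) \<lhd> b) *
      (\<Prod>i\<in>{..<length as} - {k}. emb (as ! i \<lhd>\<^sub>S fibre_prod bs f (Suc i)))))"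
  by (simp add: star_term_def der_mult der_prod der_emb sum_distrib_left)

text \<open>Expand \<open>v \<star> emb b\<close> as \<open>v * emb b + der b v\<close>. For each
  \<open>f\<close>, acting by \<open>B * b\<close> and by \<open>der b B\<close> adds up to acting
  by the fibre product \<open>B\<close> and then by \<open>b\<close>, as in the Leibniz expansion of
  \<open>der b\<close> on the term of \<open>f\<close>.\<close>

lemma star_star_emb: "u \<star> (v \<star> emb b) = (u \<star> v) \<star> emb b"
proof -
  have lists: "prod_list (map emb as) \<star> (prod_list (map emb bs) \<star> emb b) =
      (prod_list (map emb as) \<star> prod_list (map emb bs)) \<star> emb b" for as bs
  proof -
    let ?F = "{..<length bs} \<rightarrow>\<^sub>E {..length as}"
    have split: "emb ((c \<lhd>\<^sub>S w) \<lhd> b) = emb (c \<lhd>\<^sub>S (w * emb b)) + emb (c \<lhd>\<^sub>S der b w)" for c w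
      by (simp add: act_star_emb[symmetric] star_emb act_add_right emb_add)
    have "prod_list (map emb as) \<star> (prod_list (map emb bs) \<star> emb b) =
        star_list as (bs @ [b]) + (\<Sum>j<length bs. star_list as (bs[j := bs ! j \<lhd> b]))"
      using star_prod_list[of as "bs @ [b]"]
      by (simp add: star_emb[of "prod_list (map emb bs)"] star_add_right der_prod_list star_sum_right star_prod_list)
    also have "(\<Sum>j<length bs. star_list as (bs[j := bs ! j \<lhd> b])) =
        (\<Sum>f\<in>?F. \<Sum>j<length bs. star_term as (bs[j := bs ! j \<lhd> b]) f)"
      unfolding star_list_def by (subst sum.swap) simp
    \<comment> \<open>\<open>star_list_snoc\<close> expands the first summand and
      \<open>sum_star_term_update\<close> the second; \<open>split\<close> merges their
      \<open>k\<close>-th terms into those of \<open>der_star_term\<close>.\<close>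
    also have "star_list as (bs @ [b]) + \<dots> =
        (\<Sum>f\<in>?F. emb b * star_term as bs f + der b (star_term as bs f))"
      unfolding star_list_snoc sum.distrib[symmetric]
      by (intro sum.cong refl)
        (simp add: sum_star_term_update der_star_term split sum.distrib distrib_left distrib_right)
    also have "\<dots> = star_list as bs \<star> emb b"
      by (simp add: star_emb star_list_def der_sum sum_distrib_left sum.distrib mult.commute[of _ "emb b"])
    finally show ?thesis by (simp add: star_prod_list)
  qed
  have mon: "mon M \<star> (v \<star> emb b) = (mon M \<star> v) \<star> emb b" for M
    by (induction v rule: sym_induct)
      (simp_all add: star_add_left star_add_right star_scale_left star_scale_right mon_list_of lists)
  show ?thesis
    by (induction u rule: sym_induct)
      (simp_all add: star_add_left star_scale_left mon)
qed

text \<open>Used to multiply truncated series: terms of total order above \<open>N\<close>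
  vanish.\<close>

lemma sum_square_triangle:
  fixes h :: "nat \<Rightarrow> nat \<Rightarrow> 'a::comm_monoid_add"
  assumes "\<And>i j. N < i + j \<Longrightarrow> h i j = 0"
  shows "(\<Sum>i\<le>N. \<Sum>j\<le>N. h i j) = (\<Sum>m\<le>N. \<Sum>i\<le>m. h i (m - i))"
proof -
  have "(\<Sum>i\<le>N. \<Sum>j\<le>N. h i j) = (\<Sum>(i, j)\<in>{..N} \<times> {..N}. h i j)"
    by (simp add: sum.cartesian_product)
  also have "\<dots> = (\<Sum>(i, j)\<in>{(i, j). i + j \<le> N}. h i j)"
    by (rule sum.mono_neutral_right) (auto, metis assms not_le)
  also have "\<dots> = (\<Sum>m\<le>N. \<Sum>i\<le>m. h i (m - i))"
    by (rule sum.triangle_reindex_eq)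
  finally show ?thesis .
qed

text \<open>The map \<open>f\<close> may have arguments of three different types, so that products,
  actions and derivations are all covered.\<close>

lemma cauchy_reassoc:
  fixes f :: "'a \<Rightarrow> 'b \<Rightarrow> 'c \<Rightarrow> 'd::comm_monoid_add" and x :: "nat \<Rightarrow> 'a"
  shows "(\<Sum>i\<le>n. \<Sum>j\<le>i. f (x j) (y (i - j)) (z (n - i))) =
    (\<Sum>j\<le>n. \<Sum>i\<le>n - j. f (x j) (y i) (z (n - j - i)))"
  using fps_mult_assoc_lemma[of "\<lambda>i j k. f (x i) (y j) (z k)" n n] by (simp add: atLeast0AtMost)

section \<open>Powers of an element of the completion\<close>

abbreviation star_pow :: "(nat \<Rightarrow> 'k::field prelie) \<Rightarrow> nat \<Rightarrow> nat \<Rightarrow> 'k symalg" where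
  "star_pow w \<equiv> hat_pow (\<star>) (hat_emb w)"

abbreviation right_mult :: "(nat \<Rightarrow> 'k::field prelie) \<Rightarrow> (nat \<Rightarrow> 'k prelie) \<Rightarrow> nat \<Rightarrow> 'k prelie" where
  "right_mult w x \<equiv> cauchy (\<lhd>) x w"

lemma star_one: "u \<star> 1 = u"
proof (induction u rule: sym_induct)
  case (add c M u)
  have "mon M \<star> 1 = mon M"
    using star_prod_list[of "list_of M" "[]"]
    by (simp add: mon_list_of star_list_def star_term_def fibre_prod_def act_one prod_list_emb)
  with add show ?case by (simp add: star_add_left star_scale_left)
qed simp

lemma star_pow_less: "w 0 = 0 \<Longrightarrow> n < k \<Longrightarrow> star_pow w k n = 0"
  by (rule hat_pow_eq_0) (simp_all add: hat_emb_def emb_0)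

lemma star_pow_1: "star_pow w (Suc 0) n = emb (w n)"
proof -
  have "star_pow w (Suc 0) n = (\<Sum>i\<le>n. if i = 0 then emb (w (n - i)) else 0)"
    unfolding hat_pow.simps cauchy_def
    by (intro sum.cong) (simp_all add: hat_one_def hat_emb_def star_emb)
  then show ?thesis by simp
qed

lemma cauchy_hat_one: "cauchy f x hat_one n = f (x n) 1" if "\<And>u. f u 0 = 0"
proof -
  have "cauchy f x hat_one n = (\<Sum>i\<le>n. if i = n then f (x i) 1 else 0)"
    unfolding cauchy_def by (intro sum.cong) (auto simp: hat_one_def that)
  then show ?thesis by simp
qed

text \<open>\<open>hat_pow\<close> appends its new factor on the right, and this factor has its
  components in \<open>L\<close>, so \<open>star_star_emb\<close> carries the induction.\<close>

lemma star_pow_add: "cauchy (\<star>) (star_pow w m) (star_pow w n) = star_pow w (m + n)"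
proof (induction n)
  case 0
  show ?case by (rule ext) (simp add: cauchy_hat_one star_one)
next
  case (Suc n)
  have "cauchy (\<star>) (star_pow w m) (cauchy (\<star>) (star_pow w n) (hat_emb w)) N =
      cauchy (\<star>) (cauchy (\<star>) (star_pow w m) (star_pow w n)) (hat_emb w) N" for N
    using cauchy_reassoc[of "\<lambda>u v b. (u \<star> v) \<star> emb b" "star_pow w m" "star_pow w n" w N]
    by (simp add: cauchy_def hat_emb_def star_sum_right star_sum_left star_star_emb)
  with Suc show ?case by auto
qed

text \<open>Turns the action of a power series in \<open>w\<close> into a power series in the
  operator \<open>right_mult w\<close>.\<close>

lemma act_star_pow: "cauchy (\<lhd>\<^sub>S) x (star_pow w k) = (right_mult w ^^ k) x"
proof (induction k)
  case 0
  show ?case by (rule ext) (simp add: cauchy_hat_one act_one)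
next
  case (Suc k)
  have "cauchy (\<lhd>\<^sub>S) x (cauchy (\<star>) (star_pow w k) (hat_emb w)) N =
      right_mult w (cauchy (\<lhd>\<^sub>S) x (star_pow w k)) N" for N
    using cauchy_reassoc[of "\<lambda>u v b. (u \<lhd>\<^sub>S v) \<lhd> b" x "star_pow w k" w N]
    by (simp add: cauchy_def hat_emb_def act_sum_right prelie_mult_sum_left act_star_emb)
  with Suc show ?case by auto
qed

text \<open>Each right multiplication by \<open>w\<close> raises the lowest degree by at least one,
  and \<open>x\<close> already starts in degree 1; hence \<open>n \<le> k\<close> here but
  \<open>n < k\<close> in \<open>star_pow_less\<close>.\<close>

lemma right_mult_pow_less:
  assumes "w 0 = 0" "x 0 = 0" "n \<le> k"
  shows "(right_mult w ^^ k) x n = 0"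
  using \<open>n \<le> k\<close>
proof (induction k arbitrary: n)
  case (Suc k)
  have "(right_mult w ^^ k) x i \<lhd> w (n - i) = 0" if "i \<le> n" for i
    using Suc that assms by (cases "i = n") simp_all
  then show ?case unfolding funpow.simps comp_def cauchy_def[of _ "(right_mult w ^^ k) x"] by simp
qed (use assms in simp)

text \<open>Elements of the completed symmetric algebra are written as power series over
  \<open>S(L)\<close> with the degree as exponent: the product of series is then the commutative
  product, and a commutative ring results.\<close>

definition hat_der :: "(nat \<Rightarrow> 'k::field prelie) \<Rightarrow> 'k symalg fps \<Rightarrow> 'k symalg fps" where
  "hat_der w F = Abs_fps (cauchy (\<lambda>u b. der b u) (fps_nth F) w)"

lemma hat_der_add: "hat_der w (F + G) = hat_der w F + hat_der w G"
  by (simp add: hat_der_def cauchy_def der_add sum.distrib fps_eq_iff)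

lemma hat_der_mult: "hat_der w (F * G) = hat_der w F * G + F * hat_der w G"
proof (rule fps_ext)
  fix n
  \<comment> \<open>Reflecting \<open>j\<close> puts the undifferentiated factor first, so that
    \<open>cauchy_reassoc\<close> applies to both halves of the Leibniz rule.\<close>
  have "(\<Sum>j\<le>i. der (w (n - i)) (fps_nth F j) * fps_nth G (i - j)) =
      (\<Sum>j\<le>i. fps_nth G j * der (w (n - i)) (fps_nth F (i - j)))" for i
    by (rule sum.reindex_bij_witness[where i = "\<lambda>j. i - j" and j = "\<lambda>j. i - j"]) (auto simp: mult.commute)
  then have "fps_nth (hat_der w (F * G)) n =
      (\<Sum>i\<le>n. \<Sum>j\<le>i. fps_nth G j * der (w (n - i)) (fps_nth F (i - j))) +
      (\<Sum>i\<le>n. \<Sum>j\<le>i. fps_nth F j * der (w (n - i)) (fps_nth G (i - j)))"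
    by (simp add: hat_der_def cauchy_def fps_mult_nth atLeast0AtMost der_sum der_mult sum.distrib)
  also have "\<dots> = fps_nth (G * hat_der w F) n + fps_nth (F * hat_der w G) n"
    using cauchy_reassoc[of "\<lambda>u v b. u * der b v" "fps_nth G" "fps_nth F" w n]
      cauchy_reassoc[of "\<lambda>u v b. u * der b v" "fps_nth F" "fps_nth G" w n]
    by (simp add: hat_der_def cauchy_def fps_mult_nth atLeast0AtMost sum_distrib_left)
  finally show "fps_nth (hat_der w (F * G)) n = fps_nth (hat_der w F * G + F * hat_der w G) n"
    by (simp add: mult.commute)
qed

lemma hat_der_emb: "hat_der w (Abs_fps (hat_emb x)) = Abs_fps (hat_emb (right_mult w x))"
  by (simp add: hat_der_def hat_emb_def cauchy_def der_emb sum_emb fps_eq_iff)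

lemma hat_der_pow_emb:
  "(hat_der w ^^ n) (Abs_fps (hat_emb x)) = Abs_fps (hat_emb ((right_mult w ^^ n) x))"
  by (induction n) (simp_all add: hat_der_emb)

lemma star_pow_eq:
  "star_pow w n = fps_nth (((\<lambda>F. F * Abs_fps (hat_emb w) + hat_der w F) ^^ n) 1)"
proof (induction n)
  case 0
  show ?case by (auto simp: hat_one_def)
next
  case (Suc n)
  then show ?case
    by (simp add: hat_der_def cauchy_def fps_mult_nth atLeast0AtMost hat_emb_def star_emb sum.distrib fun_eq_iff)
qed

section \<open>Exponential formula for a derivation\<close>

text \<open>The left side is the coefficient of \<open>t^n\<close> in \<open>Y = exp V\<close>. With
  \<open>D\<close> acting on coefficients, \<open>V' = w + D V\<close>; so
  \<open>Y' = Y * w + D Y\<close> and \<open>Y(0) = 1\<close>, which determines \<open>Y\<close>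
  recursively. The map \<open>q\<close> embeds the scalars as constants of \<open>D\<close>, which
  allows division by factorials.\<close>

lemma derivation_exponential:
  fixes D :: "'a::comm_ring_1 \<Rightarrow> 'a" and w :: 'a and q :: "'k::field_char_0 \<Rightarrow> 'a"
  assumes D_add: "\<And>u v. D (u + v) = D u + D v" and D_mult: "\<And>u v. D (u * v) = D u * v + u * D v"
    and q: "\<And>c d. q (c + d) = q c + q d" "\<And>c d. q (c * d) = q c * q d" "q 1 = 1" "\<And>c. D (q c) = 0"
  defines "V \<equiv> Abs_fps (\<lambda>n. if n = 0 then 0 else q (1 / fact n) * (D ^^ (n - 1)) w)"
  shows "(\<Sum>k\<le>n. q (1 / fact k) * fps_nth (V ^ k) n) = q (1 / fact n) * ((\<lambda>u. u * w + D u) ^^ n) 1"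
proof -
  have D0: "D 0 = 0" using D_add[of 0 0] by simp
  have q0: "q 0 = 0" using q(1)[of 0 0] by simp
  have of_nat: "of_nat m = q (of_nat m)" for m by (induction m) (simp_all add: q q0)
  have D_sum: "D (\<Sum>i\<in>A. f i) = (\<Sum>i\<in>A. D (f i))" for A and f :: "nat \<Rightarrow> 'a"
    by (induction A rule: infinite_finite_induct) (simp_all add: D0 D_add)
  have Dq: "D (q c * u) = q c * D u" for c u by (simp add: D_mult q)
  have q_frac: "of_nat (Suc m) * (q (1 / fact (Suc m)) * u) = q (1 / fact m) * u" for m u
  proof -
    have "of_nat (Suc m) * q (1 / fact (Suc m)) = q (of_nat (Suc m) * (1 / fact (Suc m)))"
      by (simp only: of_nat q)
    also have "of_nat (Suc m) * (1 / fact (Suc m)) = (1 / fact m :: 'k)"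
      by (simp add: field_simps del: of_nat_Suc)
    finally show ?thesis by (simp add: mult.assoc[symmetric] del: of_nat_Suc)
  qed
  define DD where "DD F = Abs_fps (\<lambda>n. D (fps_nth F n))" for F
  have DD_mult: "DD (F * G) = DD F * G + F * DD G" for F G
    by (simp add: DD_def fps_eq_iff fps_mult_nth D_sum D_mult sum.distrib)
  have V': "fps_deriv V = fps_const w + DD V"
  proof (rule fps_ext)
    fix n
    have "fps_nth (fps_deriv V) n = q (1 / fact n) * (D ^^ n) w"
      by (simp add: V_def q_frac[of n, simplified] del: of_nat_Suc fact_Suc)
        (metis q_frac)
    also have "\<dots> = fps_nth (fps_const w + DD V) n"
      by (cases n) (simp_all add: V_def DD_def D0 q Dq)
    finally show "fps_nth (fps_deriv V) n = fps_nth (fps_const w + DD V) n" .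
  qed
  \<comment> \<open>The difference of \<open>fps_deriv\<close> and \<open>DD\<close> is a derivation
    that sends \<open>V\<close> to \<open>w\<close>. At \<open>k = 0\<close> the truncated exponent
    is harmless, as \<open>of_nat k\<close> vanishes.\<close>
  have deriv: "fps_deriv (V ^ k) = of_nat k * fps_const w * V ^ (k - 1) + DD (V ^ k)" for k
  proof (induction k)
    case 0
    have "D 1 = 0" using q(4)[of 1] q(3) by simp
    then show ?case by (simp add: DD_def fps_eq_iff D0)
  next
    case (Suc k)
    have "V * (of_nat k * fps_const w * V ^ (k - 1)) = of_nat k * fps_const w * V ^ k"
      by (cases k) (simp_all add: mult_ac)
    then show ?case by (simp add: V' Suc DD_mult algebra_simps)
  qed
  have V0: "fps_nth V 0 = 0" by (simp add: V_def)
  let ?Y = "\<lambda>n. \<Sum>k\<le>n. q (1 / fact k) * fps_nth (V ^ k) n"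
  have step: "of_nat (Suc n) * ?Y (Suc n) = ?Y n * w + D (?Y n)" for n
  proof -
    have nth: "fps_nth (of_nat k * fps_const w * G) n = of_nat k * (w * fps_nth G n)" for k G
      by (simp add: fps_of_nat[symmetric] mult.assoc)
    let ?g = "\<lambda>k. of_nat k * (q (1 / fact k) * (w * fps_nth (V ^ (k - 1)) n))"
    have "of_nat (Suc n) * ?Y (Suc n) = (\<Sum>k\<le>Suc n. q (1 / fact k) * fps_nth (fps_deriv (V ^ k)) n)"
      unfolding sum_distrib_left fps_deriv_nth by (intro sum.cong) (simp_all add: mult_ac)
    also have "\<dots> = (\<Sum>k\<le>Suc n. ?g k) + (\<Sum>k\<le>Suc n. q (1 / fact k) * D (fps_nth (V ^ k) n))"
      unfolding sum.distrib[symmetric]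
      by (intro sum.cong) (simp_all add: deriv nth DD_def algebra_simps)
    also have "(\<Sum>k\<le>Suc n. ?g k) = (\<Sum>k\<le>n. ?g (Suc k))"
      by (subst sum.atMost_Suc_shift) simp
    also have "\<dots> = ?Y n * w"
      unfolding q_frac sum_distrib_right by (simp add: mult_ac)
    \<comment> \<open>The term \<open>k = Suc n\<close> drops out because \<open>V\<close> has no
      constant term.\<close>
    also have "(\<Sum>k\<le>Suc n. q (1 / fact k) * D (fps_nth (V ^ k) n)) = D (?Y n)"
      using startsby_zero_power_prefix[OF V0, of "Suc n"] by (simp add: D0 D_sum Dq)
    finally show ?thesis .
  qed
  show ?thesis
  proof (induction n)
    case 0
    show ?case by (simp add: q)
  next
    case (Suc n)
    have unit: "q (1 / of_nat (Suc n)) * (of_nat (Suc n) * u) = u" for u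
    proof -
      have "q (1 / of_nat (Suc n)) * of_nat (Suc n) = q (1 / of_nat (Suc n) * of_nat (Suc n))"
        by (simp only: of_nat q)
      then show ?thesis by (simp add: mult.assoc[symmetric] q del: of_nat_Suc)
    qed
    let ?t = "((\<lambda>u. u * w + D u) ^^ n) 1"
    have "?Y (Suc n) = q (1 / of_nat (Suc n)) * (?Y n * w + D (?Y n))"
      by (simp only: unit step[symmetric])
    also have "\<dots> = q (1 / of_nat (Suc n)) * (q (1 / fact n) * (?t * w + D ?t))"
      by (simp only: Suc Dq distrib_left mult.assoc)
    also have "\<dots> = q (1 / fact (Suc n)) * (?t * w + D ?t)"
      by (simp only: mult.assoc[symmetric] q(2)[symmetric]) (simp add: mult.commute)
    finally show ?case by simp
  qed
qed

section \<open>The exponential of the Magnus element\<close>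

text \<open>The outer exponent is the power of \<open>t\<close>, the inner one the degree. The
  coefficient of \<open>t^n\<close> starts in degree \<open>n\<close>, so setting
  \<open>t = 1\<close> is a finite sum in every degree.\<close>

definition fps_graded :: "'a::zero fps fps \<Rightarrow> bool" where
  "fps_graded F \<longleftrightarrow> (\<forall>n N. N < n \<longrightarrow> fps_nth (fps_nth F n) N = 0)"

text \<open>For a graded \<open>F\<close> in the outer variable \<open>t\<close> this is the value at \<open>t = 1\<close>.\<close>

definition fps_total :: "'a::comm_monoid_add fps fps \<Rightarrow> 'a fps" where
  "fps_total F = Abs_fps (\<lambda>N. \<Sum>n\<le>N. fps_nth (fps_nth F n) N)"

lemma fps_gradedD: "fps_graded F \<Longrightarrow> N < n \<Longrightarrow> fps_nth (fps_nth F n) N = 0"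
  by (simp add: fps_graded_def)

lemma fps_graded_mult:
  fixes F G :: "'a::comm_ring_1 fps fps"
  assumes "fps_graded F" "fps_graded G"
  shows "fps_graded (F * G)"
  unfolding fps_graded_def
proof (intro allI impI)
  fix n N :: nat assume "N < n"
  then have "fps_nth (fps_nth F i) M * fps_nth (fps_nth G (n - i)) (N - M) = 0"
    if "i \<le> n" "M \<le> N" for i M
    using that fps_gradedD[OF assms(1), of M i] fps_gradedD[OF assms(2), of "N - M" "n - i"]
    by (cases "M < i") auto
  then show "fps_nth (fps_nth (F * G) n) N = 0"
    by (auto simp: fps_mult_nth fps_sum_nth intro!: sum.neutral)
qed

text \<open>Gradedness allows one bound \<open>N\<close> for the powers of \<open>t\<close> in all
  degrees up to \<open>N\<close>; the triangle of the Cauchy product becomes a square, which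
  factors.\<close>

lemma fps_total_mult:
  fixes F G :: "'a::comm_ring_1 fps fps"
  assumes "fps_graded F" "fps_graded G"
  shows "fps_total (F * G) = fps_total F * fps_total G"
proof (rule fps_ext)
  fix N
  let ?h = "\<lambda>i j. \<Sum>M\<le>N. fps_nth (fps_nth F i) M * fps_nth (fps_nth G j) (N - M)"
  have h0: "?h i j = 0" if "N < i + j" for i j
  proof (rule sum.neutral, intro ballI)
    fix M assume "M \<in> {..N}"
    then show "fps_nth (fps_nth F i) M * fps_nth (fps_nth G j) (N - M) = 0"
      using that fps_gradedD[OF assms(1), of M i] fps_gradedD[OF assms(2), of "N - M" j]
      by (cases "M < i") auto
  qed
  have total: "fps_nth (fps_total H) M = (\<Sum>n\<le>N. fps_nth (fps_nth H n) M)"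
    if "fps_graded H" "M \<le> N" for H :: "'a fps fps" and M
    using that fps_gradedD[OF that(1), of M] unfolding fps_total_def fps_nth_Abs_fps
    by (intro sum.mono_neutral_left) auto
  have "fps_nth (fps_total (F * G)) N = (\<Sum>n\<le>N. \<Sum>i\<le>n. ?h i (n - i))"
    by (simp add: fps_total_def fps_mult_nth fps_sum_nth atLeast0AtMost)
  also have "\<dots> = (\<Sum>i\<le>N. \<Sum>j\<le>N. ?h i j)"
    using sum_square_triangle[of N ?h] h0 by simp
  also have "\<dots> = (\<Sum>i\<le>N. \<Sum>M\<le>N. \<Sum>j\<le>N. fps_nth (fps_nth F i) M * fps_nth (fps_nth G j) (N - M))"
    by (intro sum.cong refl sum.swap)
  also have "\<dots> = (\<Sum>M\<le>N. \<Sum>i\<le>N. \<Sum>j\<le>N. fps_nth (fps_nth F i) M * fps_nth (fps_nth G j) (N - M))"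
    by (rule sum.swap)
  also have "\<dots> = fps_nth (fps_total F * fps_total G) N"
    by (simp add: fps_mult_nth atLeast0AtMost total assms sum_product)
  finally show "fps_nth (fps_total (F * G)) N = fps_nth (fps_total F * fps_total G) N" .
qed

lemma fps_total_power:
  fixes F :: "'a::comm_ring_1 fps fps"
  assumes "fps_graded F"
  shows "fps_graded (F ^ k) \<and> fps_total (F ^ k) = fps_total F ^ k"
proof (induction k)
  case 0
  have "fps_total (1 :: 'a fps fps) = 1"
    by (simp add: fps_eq_iff fps_total_def sum.atMost_shift)
  then show ?case by (simp add: fps_graded_def)
qed (use assms in \<open>simp add: fps_graded_mult fps_total_mult\<close>)

text \<open>The second hypothesis says that \<open>V\<close> has the value \<open>a\<close> at
  \<open>t = 1\<close>. Apply \<open>derivation_exponential\<close> to \<open>hat_der w\<close> and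
  evaluate at \<open>t = 1\<close>, which respects powers.\<close>

lemma star_pow_exponential:
  fixes w :: "nat \<Rightarrow> 'k::field_char_0 prelie"
  assumes w0: "w 0 = 0"
    and w: "\<And>N. (\<Sum>n\<le>N. prelie_scale (1 / fact (Suc n)) ((right_mult w ^^ n) w N)) = hat_gen N"
  shows "(\<Sum>n\<le>N. sym_scale (1 / fact n) (star_pow w n N)) = hat_exp (hat_emb hat_gen) N"
proof -
  define W where "W = Abs_fps (hat_emb w)"
  define q :: "'k \<Rightarrow> 'k symalg fps" where "q c = fps_const (sym_scale c 1)" for c
  define V where "V = Abs_fps (\<lambda>n. if n = 0 then 0 else q (1 / fact n) * (hat_der w ^^ (n - 1)) W)"
  have q_nth: "fps_nth (q c * F) m = sym_scale c (fps_nth F m)" for c F m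
    by (simp add: q_def sym_scale_mult_left)
  have q: "q (c + d) = q c + q d" "q (c * d) = q c * q d" "q 1 = 1" for c d
    by (simp_all add: q_def S.scale_left_distrib sym_scale_mult_left)
  have hat_der_q: "hat_der w (q c) = 0" for c
    by (auto simp: q_def fps_eq_iff hat_der_def cauchy_def der_scale intro!: sum.neutral)
  have V_nth: "fps_nth (fps_nth V (Suc n)) N = emb (prelie_scale (1 / fact (Suc n)) ((right_mult w ^^ n) w N))"
      "fps_nth V 0 = 0" for n N
    by (simp_all add: V_def q_nth W_def hat_der_pow_emb hat_emb_def emb_scale)
  have graded: "fps_graded V"
    unfolding fps_graded_def
  proof (intro allI impI)
    fix n N :: nat assume "N < n"
    then show "fps_nth (fps_nth V n) N = 0"
      using right_mult_pow_less[of w w N "n - 1", OF w0 w0] by (cases n) (simp_all add: V_nth emb_0)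
  qed
  have total: "fps_total V = fps_const (emb gen) * fps_X"
  proof (rule fps_ext)
    fix N
    show "fps_nth (fps_total V) N = fps_nth (fps_const (emb gen) * fps_X) N"
    proof (cases N)
      case 0
      then show ?thesis by (simp add: fps_total_def V_nth)
    next
      case (Suc M)
      have "fps_nth (fps_total V) N =
          emb (\<Sum>n\<le>M. prelie_scale (1 / fact (Suc n)) ((right_mult w ^^ n) w (Suc M)))"
        by (simp only: Suc fps_total_def fps_nth_Abs_fps sum.atMost_Suc_shift V_nth sum_emb) simp
      \<comment> \<open>The hypothesis has one more term, with index \<open>Suc M\<close>; it
        vanishes for degree reasons.\<close>
      also have "(\<Sum>n\<le>M. prelie_scale (1 / fact (Suc n)) ((right_mult w ^^ n) w (Suc M))) = hat_gen (Suc M)"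
        using w[of "Suc M"] right_mult_pow_less[of w w "Suc M" "Suc M", OF w0 w0] by simp
      finally show ?thesis by (simp add: Suc hat_gen_def emb_0)
    qed
  qed
  have "sym_scale (1 / fact n) (star_pow w n N) =
      (\<Sum>k\<le>N. sym_scale (1 / fact k) (fps_nth (fps_nth (V ^ k) n) N))" if "n \<le> N" for n
  proof -
    have "sym_scale (1 / fact n) (star_pow w n N) =
        (\<Sum>k\<le>n. sym_scale (1 / fact k) (fps_nth (fps_nth (V ^ k) n) N))"
      using arg_cong[OF derivation_exponential[of "hat_der w" q W n, OF hat_der_add hat_der_mult q hat_der_q], of "\<lambda>F. fps_nth F N"]
      by (simp add: star_pow_eq V_def[symmetric] W_def[symmetric] fps_sum_nth q_nth)
    also have "\<dots> = (\<Sum>k\<le>N. sym_scale (1 / fact k) (fps_nth (fps_nth (V ^ k) n) N))"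
      using that startsby_zero_power_prefix[OF V_nth(2)] by (intro sum.mono_neutral_left) auto
    finally show ?thesis .
  qed
  then have "(\<Sum>n\<le>N. sym_scale (1 / fact n) (star_pow w n N)) =
      (\<Sum>n\<le>N. \<Sum>k\<le>N. sym_scale (1 / fact k) (fps_nth (fps_nth (V ^ k) n) N))"
    by simp
  also have "\<dots> = (\<Sum>k\<le>N. sym_scale (1 / fact k) (fps_nth (fps_total (V ^ k)) N))"
    by (subst sum.swap) (simp add: fps_total_def S.scale_sum_right)
  also have "\<dots> = (\<Sum>k\<le>N. if k = N then sym_scale (1 / fact k) (emb gen ^ k) else 0)"
    by (intro sum.cong) (auto simp: fps_total_power[OF graded] total power_mult_distrib)
  also have "\<dots> = hat_exp (hat_emb hat_gen) N"
    by (simp add: hat_exp_gen)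
  finally show ?thesis .
qed

lemma bernoulli_convolution:
  "(\<Sum>i\<le>m. 1 / fact (Suc i) * (bernoulli (m - i) / fact (m - i))) = (if m = 0 then 1 else 0 :: 'k::field_char_0)"
proof -
  \<comment> \<open>As \<open>exp X - 1\<close> has no constant term, the sum is the coefficient of
    index \<open>Suc m\<close> in a product that equals \<open>X\<close>.\<close>
  have "(\<Sum>i\<le>m. 1 / fact (Suc i) * (bernoulli (m - i) / fact (m - i))) =
      fps_nth ((fps_exp 1 - 1) * Abs_fps (\<lambda>n. bernoulli n / fact n) :: 'k fps) (Suc m)"
    unfolding fps_mult_nth atLeast0AtMost sum.atMost_Suc_shift by (simp del: fact_Suc)
  also have "\<dots> = (if m = 0 then 1 else 0)"
    using bernoulli_series[where 'k = 'k] by (simp add: mult.commute)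
  finally show ?thesis .
qed

text \<open>By \<open>act_star_pow\<close> the fixed-point equation expands \<open>w\<close> as the
  Bernoulli series in the operator \<open>right_mult w\<close>, applied to the generator. The series
  with coefficients \<open>1 / fact (Suc n)\<close> is its inverse.\<close>

lemma magnus_inverse:
  fixes w :: "nat \<Rightarrow> 'k::field_char_0 prelie"
  assumes w0: "w 0 = 0" and fp: "cauchy (\<lhd>\<^sub>S) hat_gen (todd_star (hat_emb w)) = w"
  shows "(\<Sum>n\<le>N. prelie_scale (1 / fact (Suc n)) ((right_mult w ^^ n) w N)) = hat_gen N"
proof -
  let ?b = "\<lambda>k. bernoulli k / fact k :: 'k"
  let ?g = "\<lambda>k. (right_mult w ^^ k) hat_gen"
  have todd: "todd_star (hat_emb w) M = (\<Sum>k\<le>N. sym_scale (?b k) (star_pow w k M))" if "M \<le> N" for M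
    unfolding todd_star_def hat_series_def using that star_pow_less[of w, OF w0, of M]
    by (intro Sum_any.expand_superset) (auto, metis leI order_le_less_trans)
  have w_eq: "w M = (\<Sum>k\<le>N. prelie_scale (?b k) (?g k M))" if "M \<le> N" for M
  proof -
    have "w M = cauchy (\<lhd>\<^sub>S) hat_gen (todd_star (hat_emb w)) M" by (simp only: fp)
    also have "\<dots> = (\<Sum>k\<le>N. prelie_scale (?b k) (cauchy (\<lhd>\<^sub>S) hat_gen (star_pow w k) M))"
      unfolding cauchy_def using that
      by (simp add: todd act_sum_right act_scale_right L.scale_sum_right sum.swap[of _ "{..N}"] )
    finally show ?thesis by (simp only: act_star_pow)
  qed
  have pow: "(right_mult w ^^ n) w M = (\<Sum>k\<le>N. prelie_scale (?b k) (?g (n + k) M))" if "M \<le> N" for n M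
    using that
  proof (induction n arbitrary: M)
    case 0
    then show ?case by (simp add: w_eq)
  next
    case (Suc n)
    have "right_mult w ((right_mult w ^^ n) w) M =
        (\<Sum>i\<le>M. (\<Sum>k\<le>N. prelie_scale (?b k) (?g (n + k) i)) \<lhd> w (M - i))"
      unfolding cauchy_def[of _ "(right_mult w ^^ n) w"] using Suc by (intro sum.cong refl) simp
    also have "\<dots> = (\<Sum>k\<le>N. prelie_scale (?b k) (right_mult w (?g (n + k)) M))"
      unfolding cauchy_def[of _ "?g (n + _)"]
      by (simp add: prelie_mult_sum_left prelie_mult_scale_left L.scale_sum_right, rule sum.swap)
    finally show ?case by simp
  qed
  let ?h = "\<lambda>i j. prelie_scale (1 / fact (Suc i) * ?b j) (?g (i + j) N)"
  have "(\<Sum>n\<le>N. prelie_scale (1 / fact (Suc n)) ((right_mult w ^^ n) w N)) = (\<Sum>i\<le>N. \<Sum>j\<le>N. ?h i j)"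
    by (simp add: pow[OF order.refl] L.scale_sum_right)
  also have "\<dots> = (\<Sum>m\<le>N. \<Sum>i\<le>m. ?h i (m - i))"
  proof (rule sum_square_triangle)
    fix i j assume "N < i + j"
    then have "?g (i + j) N = 0" by (intro right_mult_pow_less w0) (simp_all add: hat_gen_def)
    then show "?h i j = 0" by simp
  qed
  also have "\<dots> = (\<Sum>m\<le>N. prelie_scale (if m = 0 then 1 else 0) (?g m N))"
    by (intro sum.cong refl) (simp add: bernoulli_convolution[symmetric] L.scale_sum_left)
  also have "\<dots> = hat_gen N"
    by (simp add: if_distrib[of "\<lambda>c. prelie_scale c _"] sum.atMost_shift cong: if_cong)
  finally show ?thesis .
qed

section \<open>The logarithm\<close>

text \<open>The value at \<open>w\<close> of a scalar power series. If \<open>w 0 = 0\<close>, the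
  truncation at \<open>N\<close> loses nothing, by \<open>star_pow_less\<close>.\<close>

definition star_series :: "(nat \<Rightarrow> 'k::field prelie) \<Rightarrow> 'k fps \<Rightarrow> nat \<Rightarrow> 'k symalg" where
  "star_series w a N = (\<Sum>m\<le>N. sym_scale (fps_nth a m) (star_pow w m N))"

text \<open>Exponents add under \<star>, so substitution of \<open>w\<close> is multiplicative and
  scalar identities carry over.\<close>

lemma star_series_mult:
  assumes w0: "w 0 = 0"
  shows "cauchy (\<star>) (star_series w a) (star_series w b) = star_series w (a * b)"
proof
  fix N
  let ?h = "\<lambda>i j. sym_scale (fps_nth a i * fps_nth b j) (star_pow w (i + j) N)"
  have ext: "star_series w c M = (\<Sum>m\<le>N. sym_scale (fps_nth c m) (star_pow w m M))" if "M \<le> N" for c M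
    unfolding star_series_def using that star_pow_less[of w, OF w0]
    by (intro sum.mono_neutral_left) auto
  have "cauchy (\<star>) (star_series w a) (star_series w b) N =
      (\<Sum>M\<le>N. \<Sum>i\<le>N. \<Sum>j\<le>N. sym_scale (fps_nth a i * fps_nth b j) (star_pow w i M \<star> star_pow w j (N - M)))"
    unfolding cauchy_def
    by (intro sum.cong refl)
      (simp add: ext star_sum_left star_sum_right star_scale_left star_scale_right
        S.scale_sum_right mult.commute, rule sum.swap)
  also have "\<dots> = (\<Sum>i\<le>N. \<Sum>j\<le>N. \<Sum>M\<le>N. sym_scale (fps_nth a i * fps_nth b j) (star_pow w i M \<star> star_pow w j (N - M)))"
    by (subst sum.swap) (intro sum.cong refl sum.swap)
  also have "\<dots> = (\<Sum>i\<le>N. \<Sum>j\<le>N. ?h i j)"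
    by (simp add: star_pow_add[symmetric] cauchy_def S.scale_sum_right)
  also have "\<dots> = (\<Sum>m\<le>N. \<Sum>i\<le>m. ?h i (m - i))"
    by (rule sum_square_triangle) (simp add: star_pow_less[of w, OF w0])
  also have "\<dots> = star_series w (a * b) N"
    by (simp add: star_series_def fps_mult_nth atLeast0AtMost S.scale_sum_left)
  finally show "cauchy (\<star>) (star_series w a) (star_series w b) N = star_series w (a * b) N" .
qed

lemma star_series_one: "star_series w 1 = hat_one"
  by (rule ext) (simp add: star_series_def sum.atMost_shift)

lemma star_series_pow:
  "w 0 = 0 \<Longrightarrow> hat_pow (\<star>) (star_series w a) k = star_series w (a ^ k)"
  by (induction k) (simp_all add: star_series_one star_series_mult mult.commute)

text \<open>The logarithm is the value at \<open>w\<close> of the scalar series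
  \<open>ln (1 + X)\<close> composed with \<open>exp X - 1\<close>, which is
  \<open>X\<close>.\<close>

lemma log_star_exp:
  fixes w :: "nat \<Rightarrow> 'k::field_char_0 prelie"
  assumes w0: "w 0 = 0"
  shows "log_star (star_series w (fps_exp 1)) = hat_emb w"
proof
  fix N
  let ?e = "fps_exp 1 - 1 :: 'k fps"
  let ?l = "\<lambda>k. if k = 0 then 0 else (- 1) ^ (k - 1) / of_nat k :: 'k"
  have e: "(\<lambda>n. star_series w (fps_exp 1) n - hat_one n) = star_series w ?e"
    by (rule ext) (simp add: star_series_one[of w, symmetric] star_series_def S.scale_left_diff_distrib sum_subtractf)
  have e0: "fps_nth (?e ^ k) m = 0" if "m < k" for k m
    using that startsby_zero_power_prefix[of ?e k] by simp
  have X: "(\<Sum>k\<le>N. ?l k * fps_nth (?e ^ k) m) = fps_nth fps_X m" if "m \<le> N" for m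
  proof -
    have "(\<Sum>k\<le>N. ?l k * fps_nth (?e ^ k) m) = (\<Sum>k\<le>m. ?l k * fps_nth (?e ^ k) m)"
      using that e0 by (intro sum.mono_neutral_right) auto
    also have "\<dots> = fps_nth (fps_ln 1 oo ?e) m"
      unfolding fps_compose_nth atLeast0AtMost by (intro sum.cong) (simp_all add: fps_ln_nth)
    also have "fps_ln 1 oo ?e = fps_X"
      by (simp add: fps_ln_fps_exp_inv fps_inv)
    finally show ?thesis .
  qed
  have "log_star (star_series w (fps_exp 1)) N = (\<Sum>k\<le>N. sym_scale (?l k) (star_series w (?e ^ k) N))"
    unfolding log_star_def hat_series_def e star_series_pow[of w, OF w0]
    by (intro Sum_any.expand_superset) (auto simp: star_series_def e0 not_le intro!: sum.neutral split: if_splits)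
  also have "\<dots> = (\<Sum>m\<le>N. sym_scale (fps_nth fps_X m) (star_pow w m N))"
    unfolding star_series_def S.scale_sum_right
    by (subst sum.swap, intro sum.cong refl)
      (simp only: atMost_iff S.scale_scale S.scale_sum_left[symmetric] X)
  also have "\<dots> = (\<Sum>m\<le>N. if m = 1 then emb (w N) else 0)"
    using star_pow_1[of w N] by (intro sum.cong) auto
  also have "\<dots> = hat_emb w N"
    using w0 by (cases N) (simp_all add: hat_emb_def emb_0)
  finally show "log_star (star_series w (fps_exp 1)) N = hat_emb w N" .
qed

section \<open>The projection of the exponential\<close>

lemma sol1_eqI: "u - emb x \<in> S.span (\<Union>j\<in>- {1}. pbw_component j) \<Longrightarrow> sol1 u = x"
  unfolding sol1_def by (rule the1_equality[OF sol1_ex1])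

text \<open>\<open>star_prod\<close> brackets to the right, \<open>hat_pow\<close> to the left; this
  mediates between them.\<close>

lemma star_prod_snoc: "star_prod (ls @ [x]) = star_prod ls \<star> emb x"
  by (induction ls) (simp_all add: star_prod_def star_one star_emb star_star_emb[symmetric, unfolded star_emb])

lemma star_pow_natpermute: "star_pow w n N = (\<Sum>l\<in>natpermute N n. star_prod (map w l))"
proof (induction n arbitrary: N)
  case 0
  have "natpermute N 0 = (if N = 0 then {[]} else {})" by (auto simp: natpermute_def)
  then show ?case by (simp add: hat_one_def star_prod_def)
next
  case (Suc n)
  have "star_pow w (Suc n) N = (\<Sum>i\<le>N. \<Sum>l\<in>natpermute i n. star_prod (map w (l @ [N - i])))"
    by (simp add: cauchy_def hat_emb_def Suc star_sum_left star_prod_snoc)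
  also have "\<dots> = (\<Sum>(i, l)\<in>Sigma {..N} (\<lambda>i. natpermute i n). star_prod (map w (l @ [N - i])))"
    by (rule sum.Sigma) (simp_all add: natpermute_finite)
  also have "\<dots> = (\<Sum>l\<in>natpermute N (Suc n). star_prod (map w l))"
  proof (rule sum.reindex_bij_witness[where i = "\<lambda>l. (N - last l, butlast l)" and j = "\<lambda>(i, l). l @ [N - i]"])
    fix l assume "l \<in> natpermute N (Suc n)"
    then obtain l' x where l: "l = l' @ [x]" "length l' = n" "sum_list l' + x = N"
      by (cases l rule: rev_cases) (auto simp: natpermute_def)
    then show "(case (N - last l, butlast l) of (i, l) \<Rightarrow> l @ [N - i]) = l"
      "(N - last l, butlast l) \<in> Sigma {..N} (\<lambda>i. natpermute i n)"
      by (auto simp: natpermute_def)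
  qed (auto simp: natpermute_def)
  finally show ?case .
qed

text \<open>Permuting factors only permutes the summands of \<open>star_pow_natpermute\<close>, so
  symmetrisation leaves the power unchanged: it is the image under \<open>pbw\<close> of the
  commutative power \<open>?Q\<close>.\<close>

lemma star_pow_pbw_component:
  fixes w :: "nat \<Rightarrow> 'k::field_char_0 prelie"
  shows "star_pow w n N \<in> pbw_component n"
proof -
  let ?Q = "\<Sum>l\<in>natpermute N n. prod_list (map emb (map w l))"
  let ?P = "{\<sigma>. \<sigma> permutes {..<n}}"
  have pbw_sum: "pbw (\<Sum>i\<in>A. f i) = (\<Sum>i\<in>A. pbw (f i))" for A and f :: "nat list \<Rightarrow> 'k symalg"
    by (induction A rule: infinite_finite_induct) (simp_all add: pbw_zero pbw_add)
  have reindex: "(\<Sum>l\<in>natpermute N n. star_prod (permute_list \<sigma> (map w l))) = star_pow w n N"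
    if \<sigma>: "\<sigma> \<in> ?P" for \<sigma>
    unfolding star_pow_natpermute
  proof (rule sum.reindex_bij_witness[where i = "permute_list (inv \<sigma>)" and j = "permute_list \<sigma>"])
    fix l assume l: "l \<in> natpermute N n"
    then have len: "\<sigma> permutes {..<length l}" "inv \<sigma> permutes {..<length l}"
      using \<sigma> by (auto simp: natpermute_def permutes_inv)
    have in_np: "permute_list \<tau> l \<in> natpermute N n" if "\<tau> permutes {..<length l}" for \<tau>
      using l mset_permute_list[OF that] by (auto simp: natpermute_def simp flip: sum_mset_sum_list)
    show "permute_list \<sigma> l \<in> natpermute N n" "permute_list (inv \<sigma>) l \<in> natpermute N n"
      using len by (simp_all add: in_np)
    show "permute_list (inv \<sigma>) (permute_list \<sigma> l) = l" "permute_list \<sigma> (permute_list (inv \<sigma>) l) = l"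
      using len by (simp_all add: permute_list_compose[symmetric] permutes_inv_o)
    show "star_prod (map w (permute_list \<sigma> l)) = star_prod (permute_list \<sigma> (map w l))"
      using len by (simp add: permute_list_map)
  qed
  have "pbw ?Q = (\<Sum>l\<in>natpermute N n. sym_scale (1 / fact n) (\<Sum>\<sigma>\<in>?P. star_prod (permute_list \<sigma> (map w l))))"
    unfolding pbw_sum pbw_prod_list by (intro sum.cong refl) (auto simp: pbw_list_def natpermute_def)
  also have "\<dots> = sym_scale (1 / fact n) (\<Sum>\<sigma>\<in>?P. star_pow w n N)"
    by (simp only: S.scale_sum_right[symmetric] sum.swap[of _ ?P] reindex cong: sum.cong)
  also have "\<dots> = star_pow w n N"
    by (simp add: S.sum_constant_scale card_permutations del: sum_constant)
  finally have "pbw ?Q = star_pow w n N" .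
  moreover have "?Q \<in> sym_power n"
    unfolding sym_power_def
    by (intro S.span_sum S.span_base) (auto simp: natpermute_def intro!: exI[of _ "map w _"])
  ultimately show ?thesis unfolding pbw_component_def by (metis imageI)
qed

text \<open>By \<open>star_pow_pbw_component\<close> only the linear term of the exponential
  survives the projection.\<close>

lemma sol1_star_exp:
  fixes w :: "nat \<Rightarrow> 'k::field_char_0 prelie"
  assumes w0: "w 0 = 0"
  shows "sol1 (star_series w (fps_exp 1) N) = w N"
proof (rule sol1_eqI)
  let ?K = "S.span (\<Union>j\<in>- {1}. pbw_component j) :: 'k symalg set"
  let ?f = "\<lambda>m. sym_scale (fps_nth (fps_exp 1) m) (star_pow w m N)"
  have f1: "?f 1 = emb (w N)" using star_pow_1[of w N] by simp
  have "star_series w (fps_exp 1) N - emb (w N) = (\<Sum>m\<in>{..N} - {1}. ?f m)"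
  \<comment> \<open>In degree 0 the index 1 lies outside \<open>{..N}\<close>; there
    \<open>w 0 = 0\<close> takes over.\<close>
  proof (cases "N = 0")
    case True
    then show ?thesis using w0 by (simp add: star_series_def emb_0)
  next
    case False
    then show ?thesis
      using sum.remove[of "{..N}" 1 ?f] unfolding star_series_def f1 by simp
  qed
  also have "\<dots> \<in> ?K"
    using star_pow_pbw_component[of w _ N]
    by (intro S.span_sum S.span_scale S.span_base) blast
  finally show "star_series w (fps_exp 1) N - emb (w N) \<in> ?K" .
qed

theorem theorem4:
  fixes \<Omega> :: "nat \<Rightarrow> 'k::field_char_0 prelie"
  assumes "\<Omega> \<in> completion prelie_degree"
    and "cauchy (\<lhd>\<^sub>S) hat_gen (todd_star (hat_emb \<Omega>)) = \<Omega>"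
  shows "\<Omega> = (\<lambda>n. sol1 (hat_exp (hat_emb hat_gen) n)) \<and>
    hat_emb \<Omega> = log_star (hat_exp (hat_emb hat_gen))"
proof -
  \<comment> \<open>Every bracketing has a leaf, so \<open>L\<close> has no degree 0.\<close>
  have \<Omega>0: "\<Omega> 0 = 0"
    using assms(1) prelie_degree_zero unfolding completion_def by blast
  have "star_series \<Omega> (fps_exp 1) = hat_exp (hat_emb hat_gen)"
    using star_pow_exponential[of \<Omega>, OF \<Omega>0 magnus_inverse[of \<Omega>, OF \<Omega>0 assms(2)]]
    by (auto simp: star_series_def)
  then show ?thesis
    using log_star_exp[of \<Omega>, OF \<Omega>0] sol1_star_exp[of \<Omega>, OF \<Omega>0] by auto
qed

end
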